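(* Let $K\ge2$ and let the component sizes be indexed such that $L_1\ge L_2\ge\dots\ge L_K$. The mixing time of the Markov process $(X_t)_{t\ge0}$ with activation rate $\nu$ satisfies $$t_{\rm mix}(\epsilon,\nu)=\Theta(\nu^{L_2-1}),$$ i.e. there exist $C_1(\epsilon),C_2(\epsilon)>0$ and there exists $\nu_0>0$ such that for all $\nu>\nu_0$ $$C_1(\epsilon)\,\nu^{L_2-1}\le t_{\rm mix}(\epsilon,\nu)\le C_2(\epsilon)\,\nu^{L_2-1}.$$
   Context: For positive integers $L_1,\dots,L_K$, the process $(X_t)_{t\ge0}$ (with parameter $\nu>0$) is the continuous-time Markov process on the star-shaped state space $\Omega=\{0\}\cup\{(k,l):1\le l\le L_k,\ 1\le k\le K\}$ whose only nonzero transition rates are $q(0,(k,1))=L_k\nu$; $q((k,l),(k,l+1))=(L_k-l)\nu$ for $l=1,\dots,L_k-1$; $q((k,1),0)=1$; $q((k,l),(k,l-1))=l$ for $l=2,\dots,L_k$; $k=1,\dots,K$. (It arises from a CSMA network on a complete $K$-partite interference graph with component sizes $L_1,\dots,L_K$.) Its stationary distribution $\pi$ is $\pi_0(\nu)=\big(1+\sum_{k=1}^K\sum_{l=1}^{L_k}\binom{L_k}{l}\nu^l\big)^{-1}$, $\pi_{(k,l)}(\nu)=\pi_0(\nu)\binom{L_k}{l}\nu^l$. Write $(X_t^x)_{t\ge0}$ for the process started at $x\in\Omega$. Define $d(t):=\max_{x\in\Omega}\|\mathbb{P}\{X_t^x\in\cdot\}-\pi\|_{\rm TV}$, where $\|\mu-\mu'\|_{\rm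 TV}=\max_{A\subseteq\Omega}|\mu(A)-\mu'(A)|$ is the total variation distance, and the mixing time $t_{\rm mix}(\epsilon,\nu):=\inf\{t\ge0:d(t)\le\epsilon\}$.
   Formalization: The unspecified ε is restricted to 0<ε<1, and to ε<1−1/m when L_1=L_2, where m is the number of components of maximal size; for all other ε the claimed bounds fail (e.g. t_mix=0 for ε≥1, and t_mix=o(ν^{L_2−1}) for a tie with ε≥1−1/m). *)

theory Defs
  imports "HOL-Probability.Probability"
begin

section \<open>Time-homogeneous Markov processes with given rates\<close>

text \<open>Only times \<open>t \<ge> 0\<close> and states in \<open>S\<close> are relevant here. The state space
  is meant to be finite.\<close>

definition transition_function :: "'s set \<Rightarrow> (real \<Rightarrow> 's \<Rightarrow> 's \<Rightarrow> real) \<Rightarrow> bool" where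
  "transition_function S p \<longleftrightarrow>
     (\<forall>t\<ge>0. \<forall>x\<in>S. \<forall>y\<in>S. 0 \<le> p t x y) \<and>
     (\<forall>t\<ge>0. \<forall>x\<in>S. (\<Sum>y\<in>S. p t x y) = 1) \<and>
     (\<forall>x\<in>S. \<forall>y\<in>S. p 0 x y = (if x = y then 1 else 0)) \<and>
     (\<forall>s\<ge>0. \<forall>t\<ge>0. \<forall>x\<in>S. \<forall>y\<in>S. p (s + t) x y = (\<Sum>z\<in>S. p s x z * p t z y))"

text \<open>The diagonal entries of \<open>q\<close> play no role: as \<open>p t\<close> has row sums 1, the
  off-diagonal rates determine the derivative of \<open>p\<close> at 0 on the diagonal as well.\<close>

definition has_transition_rates ::
  "'s set \<Rightarrow> ('s \<Rightarrow> 's \<Rightarrow> real) \<Rightarrow> (real \<Rightarrow> 's \<Rightarrow> 's \<Rightarrow> real) \<Rightarrow> bool" where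
  "has_transition_rates S q p \<longleftrightarrow>
     (\<forall>x\<in>S. \<forall>y\<in>S. x \<noteq> y \<longrightarrow> ((\<lambda>h. p h x y / h) \<longlongrightarrow> q x y) (at_right 0))"

text \<open>\<open>X\<close> is a Markov process on \<open>S\<close> with rates \<open>q\<close> started at \<open>x\<close>. No regularity of
  the paths is required, since only the laws of the \<open>X t\<close> matter in what follows.\<close>

definition markov_process ::
  "'w measure \<Rightarrow> 's set \<Rightarrow> ('s \<Rightarrow> 's \<Rightarrow> real) \<Rightarrow> 's \<Rightarrow> (real \<Rightarrow> 'w \<Rightarrow> 's) \<Rightarrow> bool" where
  "markov_process M S q x X \<longleftrightarrow>
     prob_space M \<and>
     (\<forall>t\<ge>0. X t \<in> measurable M (count_space S)) \<and>
     (AE \<omega> in M. X 0 \<omega> = x) \<and>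
     (\<exists>p. transition_function S p \<and> has_transition_rates S q p \<and>
       (\<forall>(n::nat) (t::nat \<Rightarrow> real) (i::nat \<Rightarrow> 's). \<forall>y\<in>S.
          0 \<le> t 0 \<longrightarrow> strict_mono_on {..Suc n} t \<longrightarrow>
          \<P>(\<omega> in M. \<forall>m\<le>n. X (t m) \<omega> = i m) > 0 \<longrightarrow>
          \<P>(\<omega> in M. X (t (Suc n)) \<omega> = y \<bar> \<forall>m\<le>n. X (t m) \<omega> = i m)
            = p (t (Suc n) - t n) (i n) y))"

section \<open>Total variation distance and mixing time\<close>

definition tv_dist :: "'s set \<Rightarrow> 's measure \<Rightarrow> 's measure \<Rightarrow> real" where
  "tv_dist S \<mu> \<mu>' = (MAX A\<in>Pow S. \<bar>measure \<mu> A - measure \<mu>' A\<bar>)"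

text \<open>Below, \<open>X x\<close> on \<open>M x\<close> is the process started at \<open>x\<close>.\<close>

definition max_tv_dist ::
  "'s set \<Rightarrow> ('s \<Rightarrow> 'w measure) \<Rightarrow> ('s \<Rightarrow> real \<Rightarrow> 'w \<Rightarrow> 's) \<Rightarrow> 's measure \<Rightarrow> real \<Rightarrow> real" where
  "max_tv_dist S M X \<pi> t =
     (MAX x\<in>S. tv_dist S (distr (M x) (count_space S) (X x t)) \<pi>)"

text \<open>Extended reals, so that the infimum of the empty set is \<open>\<infinity>\<close>.\<close>

definition mixing_time ::
  "'s set \<Rightarrow> ('s \<Rightarrow> 'w measure) \<Rightarrow> ('s \<Rightarrow> real \<Rightarrow> 'w \<Rightarrow> 's) \<Rightarrow> 's measure \<Rightarrow> real \<Rightarrow> ereal" where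
  "mixing_time S M X \<pi> \<epsilon> = (INF t\<in>{t. 0 \<le> t \<and> max_tv_dist S M X \<pi> t \<le> \<epsilon>}. ereal t)"

section \<open>The star-shaped chain\<close>

datatype star_state = Center | Branch nat nat

definition star_space :: "nat \<Rightarrow> (nat \<Rightarrow> nat) \<Rightarrow> star_state set" where
  "star_space K L = {Center} \<union> {Branch k l | k l. 1 \<le> k \<and> k \<le> K \<and> 1 \<le> l \<and> l \<le> L k}"

fun star_rate :: "(nat \<Rightarrow> nat) \<Rightarrow> real \<Rightarrow> star_state \<Rightarrow> star_state \<Rightarrow> real" where
  "star_rate L \<nu> Center Center = 0"
| "star_rate L \<nu> Center (Branch k l) = (if l = 1 then real (L k) * \<nu> else 0)"
| "star_rate L \<nu> (Branch k l) Center = (if l = 1 then 1 else 0)"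
| "star_rate L \<nu> (Branch k l) (Branch k' l') =
     (if k' = k \<and> l' = l + 1 then (real (L k) - real l) * \<nu>
      else if k' = k \<and> l = l' + 1 then real l
      else 0)"

definition star_pi0 :: "nat \<Rightarrow> (nat \<Rightarrow> nat) \<Rightarrow> real \<Rightarrow> real" where
  "star_pi0 K L \<nu> = inverse (1 + (\<Sum>k=1..K. \<Sum>l=1..L k. real (L k choose l) * \<nu> ^ l))"

fun star_pi :: "nat \<Rightarrow> (nat \<Rightarrow> nat) \<Rightarrow> real \<Rightarrow> star_state \<Rightarrow> real" where
  "star_pi K L \<nu> Center = star_pi0 K L \<nu>"
| "star_pi K L \<nu> (Branch k l) = star_pi0 K L \<nu> * real (L k choose l) * \<nu> ^ l"

definition star_stationary :: "nat \<Rightarrow> (nat \<Rightarrow> nat) \<Rightarrow> real \<Rightarrow> star_state measure" where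
  "star_stationary K L \<nu> = point_measure (star_space K L) (\<lambda>x. ennreal (star_pi K L \<nu> x))"

lemma star_pi_detailed_balance:
  assumes "x \<in> star_space K L" "y \<in> star_space K L"
  shows "star_pi K L \<nu> x * star_rate L \<nu> x y = star_pi K L \<nu> y * star_rate L \<nu> y x"
proof -
  have *: "real (n choose l) * (real n - real l) = real (n choose Suc l) * (1 + real l)"
    if "Suc l \<le> n" for n l
  proof -
    have "(n choose l) * (n - l) = (n choose Suc l) * Suc l"
      using that binomial_absorb_comp[of n l] Suc_times_binomial_eq[of "n - 1" l]
      by (cases n) (auto simp: mult.commute)
    then have "real ((n choose l) * (n - l)) = real ((n choose Suc l) * Suc l)"
      by (rule arg_cong)
    with that show ?thesis by (simp add: of_nat_diff algebra_simps)
  qed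
  show ?thesis
    using assms *
    by (cases x; cases y) (auto simp: star_space_def ac_simps)
qed

end

theory Submission
  imports Defs
begin

text \<open>At large \<open>\<nu>\<close> the stationary mass sits at the tips of the branches of maximal size, and the chain
moves between branches only through the center, against a drift of order \<open>\<nu>\<close>. Leaving a branch of
size \<open>l\<close> from its tip takes time of order \<open>\<nu> ^ (l - 1)\<close>. The slowest start that matters is the tip of branch 2: a
start in branch 1 is either close to equilibrium (if \<open>L 1 > L 2\<close>) or symmetric to a start in branch 2
(if \<open>L 1 = L 2\<close>).

The lower bound starts the chain at the tip \<open>x\<close> of branch 2. Reversibility gives
\<open>p t x y \<le> \<pi> y / \<pi> x\<close>, so the probability flow out of the branch is at every time at most the ratio of
the weights of level 1 and of the tip, that is \<open>L 2 / \<nu> ^ (L 2 - 1)\<close> (\<open>stay_prob_ge\<close>,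
\<open>branch_stay_prob\<close>). Before a small multiple of \<open>\<nu> ^ (L 2 - 1)\<close> the chain is therefore still in branch 2 with
probability close to 1, while the stationary mass of branch 2 is at most a constant below \<open>1 - \<epsilon>\<close>
(\<open>second_branch_mass_tie\<close>, \<open>second_branch_mass_strict\<close>).

For the upper bound, an estimate by the spectral gap would lose a factor of order \<open>ln \<nu>\<close>, as the smallest
stationary mass is a negative power of \<open>\<nu>\<close>. Doeblin's condition does not see small masses: all states reach the tip \<open>a\<close> of branch 1 in mean time at most a constant times
\<open>\<nu> ^ (L 2 - 1)\<close>. The mean hitting time is explicit, because the star is a tree
(\<open>mean_hitting_time_generator\<close>, \<open>mean_hitting_time_bounds\<close>). As \<open>\<pi> a\<close> is bounded below and
\<open>p t a a \<ge> \<pi> a\<close> for all \<open>t\<close>, this yields a time \<open>T\<close> of order \<open>\<nu> ^ (L 2 - 1)\<close> and a constant \<open>c > 0\<close>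
independent of \<open>\<nu>\<close> with \<open>p T x a \<ge> c\<close> for all \<open>x\<close> (\<open>minorization\<close>, \<open>star_minorization\<close>). Hence
\<open>n\<close> periods of length \<open>T\<close> bring the total variation distance down to \<open>(1 - c) ^ n\<close>
(\<open>geometric_convergence\<close>), and a number \<open>n\<close> depending only on \<open>\<epsilon>\<close>, \<open>K\<close> and \<open>L\<close> suffices.\<close>

section \<open>Transition semigroups with given rates\<close>

locale rate_semigroup =
  fixes S :: "'s set" and q :: "'s \<Rightarrow> 's \<Rightarrow> real" and p :: "real \<Rightarrow> 's \<Rightarrow> 's \<Rightarrow> real"
  assumes finite_space: "finite S"
    and transition: "transition_function S p"
    and rates: "has_transition_rates S q p"
begin

definition evolve :: "real \<Rightarrow> ('s \<Rightarrow> real) \<Rightarrow> 's \<Rightarrow> real" where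
  "evolve t f x = (\<Sum>y\<in>S. p t x y * f y)"

text \<open>The generator, written so that the diagonal of \<open>q\<close> drops out: the rates constrain the semigroup
  only off the diagonal.\<close>
definition gen :: "('s \<Rightarrow> real) \<Rightarrow> 's \<Rightarrow> real" where
  "gen f x = (\<Sum>y\<in>S. q x y * (f y - f x))"

lemma p_nonneg: "t \<ge> 0 \<Longrightarrow> x \<in> S \<Longrightarrow> y \<in> S \<Longrightarrow> 0 \<le> p t x y"
  and p_row: "t \<ge> 0 \<Longrightarrow> x \<in> S \<Longrightarrow> (\<Sum>y\<in>S. p t x y) = 1"
  and p_0: "x \<in> S \<Longrightarrow> y \<in> S \<Longrightarrow> p 0 x y = (if x = y then 1 else 0)"
  and p_add: "s \<ge> 0 \<Longrightarrow> t \<ge> 0 \<Longrightarrow> x \<in> S \<Longrightarrow> y \<in> S \<Longrightarrow> p (s + t) x y = (\<Sum>z\<in>S. p s x z * p t z y)"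
  using transition unfolding transition_function_def by blast+

lemma p_le_1: "t \<ge> 0 \<Longrightarrow> x \<in> S \<Longrightarrow> y \<in> S \<Longrightarrow> p t x y \<le> 1"
  using member_le_sum[of y S "p t x"] p_row[of t x] finite_space p_nonneg[of t x] by auto

lemma evolve_0: "x \<in> S \<Longrightarrow> evolve 0 f x = f x"
  using finite_space by (simp add: evolve_def p_0 if_distrib[of "\<lambda>c. c * _"] cong: if_cong)

lemma evolve_add:
  assumes "s \<ge> 0" "t \<ge> 0" "x \<in> S"
  shows "evolve (s + t) f x = evolve s (evolve t f) x"
proof -
  have "evolve (s + t) f x = (\<Sum>y\<in>S. \<Sum>z\<in>S. p s x z * p t z y * f y)"
    using assms by (simp add: evolve_def p_add sum_distrib_right)
  also have "\<dots> = (\<Sum>z\<in>S. \<Sum>y\<in>S. p s x z * p t z y * f y)"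
    by (rule sum.swap)
  finally show ?thesis
    by (simp add: evolve_def sum_distrib_left mult.assoc)
qed

lemma evolve_indicator:
  assumes "A \<subseteq> S"
  shows "evolve t (indicator A) x = (\<Sum>y\<in>A. p t x y)"
  using assms finite_space unfolding evolve_def
  by (intro sum.mono_neutral_cong_right) (auto simp: indicator_def)

lemma evolve_indicator_single: "y \<in> S \<Longrightarrow> evolve t (indicator {y}) x = p t x y"
  by (simp add: evolve_indicator)

lemma evolve_diff_eq:
  assumes "t \<ge> 0" "x \<in> S"
  shows "evolve t f x - c = (\<Sum>y\<in>S. p t x y * (f y - c))"
proof -
  have "(\<Sum>y\<in>S. p t x y * (f y - c)) = evolve t f x - (\<Sum>y\<in>S. p t x y) * c"
    by (simp add: evolve_def right_diff_distrib sum_subtractf sum_distrib_right)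
  then show ?thesis using p_row[OF assms] by simp
qed

lemma gen_limit:
  assumes x: "x \<in> S"
  shows "((\<lambda>h. (evolve h f x - f x) / h) \<longlongrightarrow> gen f x) (at_right 0)"
proof -
  have "((\<lambda>h. \<Sum>y\<in>S. p h x y / h * (f y - f x)) \<longlongrightarrow> gen f x) (at_right 0)"
    unfolding gen_def
  proof (rule tendsto_sum)
    fix y assume "y \<in> S"
    show "((\<lambda>h. p h x y / h * (f y - f x)) \<longlongrightarrow> q x y * (f y - f x)) (at_right 0)"
    proof (cases "x = y")
      case False
      then have "((\<lambda>h. p h x y / h) \<longlongrightarrow> q x y) (at_right 0)"
        using rates x \<open>y \<in> S\<close> by (simp add: has_transition_rates_def)
      then show ?thesis by (intro tendsto_intros)
    qed simp
  qed
  moreover have "\<forall>\<^sub>F h in at_right 0.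
      (\<Sum>y\<in>S. p h x y / h * (f y - f x)) = (evolve h f x - f x) / h"
    by (rule eventually_at_right_less[THEN eventually_mono])
       (simp add: evolve_diff_eq x sum_divide_distrib)
  ultimately show ?thesis by (rule Lim_transform_eventually)
qed

lemma evolve_limit_0:
  assumes x: "x \<in> S"
  shows "((\<lambda>h. evolve h f x - f x) \<longlongrightarrow> 0) (at_right 0)"
proof -
  have "((\<lambda>h. (evolve h f x - f x) / h * h) \<longlongrightarrow> gen f x * 0) (at_right 0)"
    by (intro tendsto_mult gen_limit x tendsto_ident_at)
  moreover have "\<forall>\<^sub>F h in at_right 0. (evolve h f x - f x) / h * h = evolve h f x - f x"
    by (rule eventually_at_right_less[THEN eventually_mono]) simp
  ultimately show ?thesis by (simp add: tendsto_cong)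
qed

text \<open>One formula for the difference quotients on both sides of \<open>t\<close>. The rates only give a
  right derivative at time 0, but as the difference quotient is \<open>p (min s t)\<close> applied to a right
  difference quotient at time 0, continuity of \<open>p\<close> suffices for a two-sided derivative at \<open>t\<close>.\<close>
lemma evolve_increment:
  assumes "s \<ge> 0" "t \<ge> 0" "x \<in> S"
  shows "(evolve s f x - evolve t f x) / (s - t) =
    (\<Sum>z\<in>S. p (min s t) x z * ((evolve \<bar>s - t\<bar> f z - f z) / \<bar>s - t\<bar>))"
proof -
  have *: "evolve (a + h) f x - evolve a f x = (\<Sum>z\<in>S. p a x z * (evolve h f z - f z))"
    if "a \<ge> 0" "h \<ge> 0" for a h
    using that assms
    by (simp add: evolve_add) (simp add: evolve_def right_diff_distrib sum_subtractf)
  show ?thesis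
  proof (cases "s \<le> t")
    case True
    have "(evolve s f x - evolve t f x) / (s - t) = (evolve t f x - evolve s f x) / (t - s)"
      using minus_divide_divide[of "evolve t f x - evolve s f x" "t - s"] by simp
    also have "\<dots> = (\<Sum>z\<in>S. p s x z * ((evolve (t - s) f z - f z) / (t - s)))"
      using *[of s "t - s"] assms True by (simp add: sum_divide_distrib)
    finally show ?thesis using True by (simp add: min_def)
  next
    case False
    then have "(evolve s f x - evolve t f x) / (s - t) =
        (\<Sum>z\<in>S. p t x z * ((evolve (s - t) f z - f z) / (s - t)))"
      using *[of t "s - t"] assms by (simp add: sum_divide_distrib)
    then show ?thesis using False by (simp add: min_def)
  qed
qed

lemma abs_diff_at_right:
  "filterlim (\<lambda>s::real. \<bar>s - t\<bar>) (at_right 0) (at t within A)"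
  unfolding filterlim_at
proof
  show "\<forall>\<^sub>F s in at t within A. \<bar>s - t\<bar> \<in> {0<..} \<and> \<bar>s - t\<bar> \<noteq> 0"
    by (simp add: eventually_at_filter)
  show "((\<lambda>s. \<bar>s - t\<bar>) \<longlongrightarrow> 0) (at t within A)"
    by (auto intro!: tendsto_eq_intros)
qed

lemma p_continuous:
  assumes t: "t \<ge> 0" and x: "x \<in> S" and y: "y \<in> S"
  shows "((\<lambda>s. p (min s t) x y) \<longlongrightarrow> p t x y) (at t within {0..})"
proof -
  let ?f = "indicator {y}"
  let ?b = "\<lambda>h. \<Sum>z\<in>S. \<bar>evolve h ?f z - ?f z\<bar>"
  have "(?b \<longlongrightarrow> (\<Sum>z\<in>S. \<bar>0\<bar>)) (at_right 0)"
    by (intro tendsto_sum tendsto_rabs evolve_limit_0)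
  then have lim: "((\<lambda>s. ?b \<bar>s - t\<bar>) \<longlongrightarrow> 0) (at t within {0..})"
    using filterlim_compose[OF _ abs_diff_at_right] by simp
  have "\<bar>p (min s t) x y - p t x y\<bar> \<le> ?b \<bar>s - t\<bar>" if "s \<ge> 0" for s
  proof (cases "s < t")
    case True
    have "evolve t ?f x - evolve s ?f x = (\<Sum>z\<in>S. p s x z * (evolve (t - s) ?f z - ?f z))"
      using evolve_add[of s "t - s" x ?f] that True x
      by (simp add: evolve_def[of s] right_diff_distrib sum_subtractf)
    then have "\<bar>p s x y - p t x y\<bar> = \<bar>\<Sum>z\<in>S. p s x z * (evolve (t - s) ?f z - ?f z)\<bar>"
      using abs_minus_commute[of "p s x y" "p t x y"] y by (simp add: evolve_indicator_single)
    also have "\<dots> \<le> (\<Sum>z\<in>S. \<bar>p s x z * (evolve (t - s) ?f z - ?f z)\<bar>)"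
      by (rule sum_abs)
    also have "\<dots> \<le> ?b (t - s)"
      using p_nonneg[of s x] p_le_1[of s x] that x
      by (intro sum_mono) (auto simp: abs_mult intro!: mult_left_le_one_le)
    finally show ?thesis using True by (simp add: min_def abs_if)
  qed (simp add: min_def sum_nonneg)
  then have "((\<lambda>s. p (min s t) x y - p t x y) \<longlongrightarrow> 0) (at t within {0..})"
    by (intro Lim_null_comparison[OF _ lim]) (auto simp: eventually_at_filter)
  then show ?thesis by (simp add: LIM_zero_iff)
qed

lemma forward_equation:
  assumes t: "t \<ge> 0" and x: "x \<in> S"
  shows "((\<lambda>s. evolve s f x) has_real_derivative evolve t (gen f) x) (at t within {0..})"
proof -
  have "((\<lambda>s. \<Sum>z\<in>S. p (min s t) x z * ((evolve \<bar>s - t\<bar> f z - f z) / \<bar>s - t\<bar>)) \<longlongrightarrow>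
      evolve t (gen f) x) (at t within {0..})"
    unfolding evolve_def[of t]
    by (intro tendsto_sum tendsto_mult p_continuous t x)
       (auto intro: filterlim_compose[OF gen_limit abs_diff_at_right])
  moreover have "\<forall>\<^sub>F s in at t within {0..}.
    (\<Sum>z\<in>S. p (min s t) x z * ((evolve \<bar>s - t\<bar> f z - f z) / \<bar>s - t\<bar>)) =
    (evolve s f x - evolve t f x) / (s - t)"
    using t x by (auto simp: eventually_at_filter evolve_increment intro!: always_eventually)
  ultimately show ?thesis
    unfolding has_field_derivative_iff by (rule Lim_transform_eventually)
qed

text \<open>Both sides are the right derivative at 0 of \<open>h \<mapsto> evolve (t + h) f x\<close>, as
  \<open>evolve t\<close> and \<open>evolve h\<close> commute. Together with the forward equation this gives the backward
  equation.\<close>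
lemma gen_commute:
  assumes t: "t \<ge> 0" and x: "x \<in> S"
  shows "evolve t (gen f) x = gen (evolve t f) x"
proof (rule tendsto_unique)
  show "((\<lambda>h. \<Sum>z\<in>S. p t x z * ((evolve h f z - f z) / h)) \<longlongrightarrow> evolve t (gen f) x) (at_right 0)"
    unfolding evolve_def[of t] by (intro tendsto_sum tendsto_mult tendsto_const gen_limit)
  have "\<forall>\<^sub>F h in at_right 0. (evolve h (evolve t f) x - evolve t f x) / h =
     (\<Sum>z\<in>S. p t x z * ((evolve h f z - f z) / h))"
  proof (rule eventually_at_right_less[THEN eventually_mono])
    fix h :: real assume "0 < h"
    then have "evolve h (evolve t f) x = evolve t (evolve h f) x"
      using evolve_add[of h t x f] evolve_add[of t h x f] t x by (simp add: add.commute)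
    then show "(evolve h (evolve t f) x - evolve t f x) / h =
       (\<Sum>z\<in>S. p t x z * ((evolve h f z - f z) / h))"
      by (simp add: evolve_def[of t] right_diff_distrib sum_subtractf[symmetric]
          sum_divide_distrib)
  qed
  then show "((\<lambda>h. \<Sum>z\<in>S. p t x z * ((evolve h f z - f z) / h)) \<longlongrightarrow> gen (evolve t f) x) (at_right 0)"
    by (rule Lim_transform_eventually[OF gen_limit[OF x]])
qed simp

text \<open>If every row of \<open>p t\<close> puts mass at least \<open>c\<close> on the same state \<open>a\<close>, all averages
  \<open>evolve t f x\<close> share the contribution \<open>c * f a\<close> and can only differ on the remaining mass \<open>1 - c\<close>.
  Subtracting the two bounds leaves the width \<open>(1 - c) * d\<close>.\<close>
lemma evolve_range:
  assumes minor: "\<And>x. x \<in> S \<Longrightarrow> c \<le> p t x a"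
    and t: "t \<ge> 0" and x: "x \<in> S" and a: "a \<in> S"
    and f: "\<And>y. y \<in> S \<Longrightarrow> m \<le> f y \<and> f y \<le> m + d"
  shows "m + c * (f a - m) \<le> evolve t f x" "evolve t f x \<le> m + d - c * (m + d - f a)"
proof -
  have "c * (f a - m) \<le> p t x a * (f a - m)"
    using minor[OF x] f[OF a] by (intro mult_right_mono) auto
  also have "\<dots> \<le> (\<Sum>y\<in>S. p t x y * (f y - m))"
    using f p_nonneg[OF t x]
    by (intro member_le_sum[OF a, of "\<lambda>y. p t x y * (f y - m)"] finite_space) auto
  finally show "m + c * (f a - m) \<le> evolve t f x"
    using evolve_diff_eq[OF t x, of f m] by simp
  have "c * (m + d - f a) \<le> p t x a * (m + d - f a)"
    using minor[OF x] f[OF a] by (intro mult_right_mono) auto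
  also have "\<dots> \<le> (\<Sum>y\<in>S. p t x y * (m + d - f y))"
    using f p_nonneg[OF t x]
    by (intro member_le_sum[OF a, of "\<lambda>y. p t x y * (m + d - f y)"] finite_space) auto
  also have "\<dots> = (\<Sum>y\<in>S. - (p t x y * (f y - (m + d))))"
    by (simp add: algebra_simps)
  also have "\<dots> = m + d - evolve t f x"
    using evolve_diff_eq[OF t x, of f "m + d"] by (simp add: sum_negf)
  finally show "evolve t f x \<le> m + d - c * (m + d - f a)" by simp
qed

lemma oscillation_contracts:
  assumes minor: "\<And>x. x \<in> S \<Longrightarrow> c \<le> p t x a"
    and t: "t \<ge> 0" and a: "a \<in> S" and f: "\<And>y. y \<in> S \<Longrightarrow> 0 \<le> f y \<and> f y \<le> 1"
  shows "\<exists>m. \<forall>x\<in>S. m \<le> evolve (real n * t) f x \<and> evolve (real n * t) f x \<le> m + (1 - c) ^ n"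
proof (induction n)
  case 0
  show ?case using f by (intro exI[of _ 0]) (simp add: evolve_0)
next
  case (Suc n)
  then obtain m where m: "\<And>x. x \<in> S \<Longrightarrow>
    m \<le> evolve (real n * t) f x \<and> evolve (real n * t) f x \<le> m + (1 - c) ^ n" by auto
  let ?g = "evolve (real n * t) f"
  have eq: "evolve (real (Suc n) * t) f x = evolve t ?g x" if "x \<in> S" for x
    using evolve_add[of t "real n * t" x f] t that by (simp add: algebra_simps)
  show ?case
  proof (intro exI[of _ "m + c * (?g a - m)"] ballI)
    fix x assume x: "x \<in> S"
    have "m + (1 - c) ^ n - c * (m + (1 - c) ^ n - ?g a) = m + c * (?g a - m) + (1 - c) ^ Suc n"
      by (simp add: algebra_simps)
    with evolve_range[OF minor t x a, of m ?g "(1 - c) ^ n"] m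
    show "m + c * (?g a - m) \<le> evolve (real (Suc n) * t) f x \<and>
      evolve (real (Suc n) * t) f x \<le> m + c * (?g a - m) + (1 - c) ^ Suc n"
      unfolding eq[OF x] by simp
  qed
qed

end

section \<open>Reversible semigroups\<close>

locale reversible_semigroup = rate_semigroup S q p
  for S :: "'s set" and q p +
  fixes \<pi> :: "'s \<Rightarrow> real"
  assumes pi_pos: "x \<in> S \<Longrightarrow> 0 < \<pi> x"
    and pi_sum: "(\<Sum>x\<in>S. \<pi> x) = 1"
    and detailed_balance: "x \<in> S \<Longrightarrow> y \<in> S \<Longrightarrow> \<pi> x * q x y = \<pi> y * q y x"
begin

text \<open>The terms with \<open>f x * g x\<close> agree on both sides, and detailed balance exchanges the
  endpoints of a transition in the others.\<close>
lemma gen_symmetric: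
  "(\<Sum>x\<in>S. \<pi> x * (f x * gen g x)) = (\<Sum>x\<in>S. \<pi> x * (g x * gen f x))"
proof -
  have db: "\<pi> x * (g x * (q x y * f y)) = \<pi> y * (g x * (q y x * f y))" if "x \<in> S" "y \<in> S" for x y
    using detailed_balance[OF that] by (simp add: algebra_simps)
  have "(\<Sum>x\<in>S. \<pi> x * (g x * gen f x)) - (\<Sum>x\<in>S. \<pi> x * (f x * gen g x)) =
    (\<Sum>x\<in>S. \<Sum>y\<in>S. \<pi> x * (g x * (q x y * f y))) - (\<Sum>x\<in>S. \<Sum>y\<in>S. \<pi> x * (f x * (q x y * g y)))"
    by (simp add: gen_def sum_distrib_left sum_subtractf[symmetric] algebra_simps)
  also have "(\<Sum>x\<in>S. \<Sum>y\<in>S. \<pi> x * (g x * (q x y * f y))) =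
      (\<Sum>x\<in>S. \<Sum>y\<in>S. \<pi> y * (g x * (q y x * f y)))"
    by (intro sum.cong refl db)
  also have "\<dots> = (\<Sum>y\<in>S. \<Sum>x\<in>S. \<pi> y * (g x * (q y x * f y)))"
    by (rule sum.swap)
  finally show ?thesis by (simp add: algebra_simps)
qed

lemma sum_pi_gen: "(\<Sum>x\<in>S. \<pi> x * gen f x) = 0"
  using gen_symmetric[of "\<lambda>_. 1" f] by (simp add: gen_def)

text \<open>The pairing of \<open>evolve s f\<close> with \<open>evolve (t - s) g\<close> in the inner product weighted by \<open>\<pi>\<close>
  does not depend on \<open>s\<close>: its derivative vanishes because the generator is symmetric. The claim
  compares \<open>s = 0\<close> with \<open>s = t\<close>. In this way the semigroup inherits reversibility from its rates
  without an appeal to uniqueness of the semigroup.\<close>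
lemma evolve_symmetric:
  assumes t: "t \<ge> 0"
  shows "(\<Sum>x\<in>S. \<pi> x * (f x * evolve t g x)) = (\<Sum>x\<in>S. \<pi> x * (g x * evolve t f x))"
proof -
  define F where "F s = (\<Sum>x\<in>S. \<pi> x * (evolve s f x * evolve (t - s) g x))" for s
  have "(F has_real_derivative 0) (at s within {0..t})" if s: "s \<in> {0..t}" for s
  proof -
    have 1: "((\<lambda>s. evolve s f x) has_real_derivative gen (evolve s f) x) (at s within {0..t})"
      if "x \<in> S" for x
      using forward_equation[of s x f] that s
      by (auto simp: gen_commute intro: DERIV_subset)
    have 2: "((\<lambda>s. evolve (t - s) g x) has_real_derivative - gen (evolve (t - s) g) x)
      (at s within {0..t})" if "x \<in> S" for x
    proof -
      have "((\<lambda>s. evolve s g x) has_real_derivative gen (evolve (t - s) g) x)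
          (at (t - s) within (\<lambda>s. t - s) ` {0..t})"
        using forward_equation[of "t - s" x g] that s
        by (auto simp: gen_commute intro: DERIV_subset)
      then have "((\<lambda>s. evolve s g x) \<circ> (\<lambda>s. t - s) has_real_derivative
          gen (evolve (t - s) g) x * (-1)) (at s within {0..t})"
        by (rule DERIV_image_chain) (auto intro!: derivative_eq_intros)
      then show ?thesis by (simp add: o_def)
    qed
    have "(F has_real_derivative (\<Sum>x\<in>S. \<pi> x * (gen (evolve s f) x * evolve (t - s) g x
        + - gen (evolve (t - s) g) x * evolve s f x))) (at s within {0..t})"
      unfolding F_def by (intro DERIV_sum DERIV_cmult DERIV_mult 1 2)
    moreover have "(\<Sum>x\<in>S. \<pi> x * (gen (evolve s f) x * evolve (t - s) g x
        + - gen (evolve (t - s) g) x * evolve s f x)) = 0"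
      using gen_symmetric[of "evolve s f" "evolve (t - s) g"]
      by (simp add: algebra_simps sum_subtractf)
    ultimately show ?thesis by simp
  qed
  then obtain c where "\<And>s. s \<in> {0..t} \<Longrightarrow> F s = c"
    using has_field_derivative_zero_constant[of "{0..t}" F] by auto
  then have "F 0 = F t" using t by simp
  then show ?thesis using t by (simp add: F_def evolve_0 mult.commute mult.left_commute)
qed

lemma evolve_stationary:
  assumes t: "t \<ge> 0"
  shows "(\<Sum>x\<in>S. \<pi> x * evolve t f x) = (\<Sum>x\<in>S. \<pi> x * f x)"
proof -
  have "evolve t (\<lambda>_. 1) x = 1" if "x \<in> S" for x
    using p_row[OF t that] by (simp add: evolve_def)
  then show ?thesis
    using evolve_symmetric[OF t, of "\<lambda>_. 1" f] by simp
qed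

lemma reversible:
  assumes t: "t \<ge> 0" and x: "x \<in> S" and y: "y \<in> S"
  shows "\<pi> x * p t x y = \<pi> y * p t y x"
proof -
  have *: "(\<Sum>z\<in>S. \<pi> z * (indicator {u} z * evolve t (indicator {v}) z)) = \<pi> u * p t u v"
    if "u \<in> S" "v \<in> S" for u v
    using that finite_space
    by (subst sum.mono_neutral_right[of S "{u}"]) (auto simp: evolve_indicator_single)
  show ?thesis
    using evolve_symmetric[OF t, of "indicator {x}" "indicator {y}"] x y by (simp add: *)
qed

lemma p_le_pi_ratio:
  assumes "t \<ge> 0" "x \<in> S" "y \<in> S"
  shows "p t x y \<le> \<pi> y / \<pi> x"
proof -
  have "\<pi> x * p t x y \<le> \<pi> y * 1"
    unfolding reversible[OF assms]
    using p_le_1[of t y x] pi_pos[of y] assms by (intro mult_left_mono) auto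
  then show ?thesis
    using pi_pos[of x] assms by (simp add: pos_le_divide_eq mult.commute)
qed

text \<open>Reversibility turns \<open>p t a a\<close> into \<open>\<pi> a\<close> times the \<open>\<pi>\<close>-mean of the square of the density
  \<open>p (t / 2) a z / \<pi> z\<close>, and this density has mean 1. Expanding the square around 1 state by state
  gives the Cauchy--Schwarz inequality in the form needed.\<close>
lemma return_prob_ge:
  assumes t: "t \<ge> 0" and a: "a \<in> S"
  shows "\<pi> a \<le> p t a a"
proof -
  let ?u = "p (t / 2) a"
  \<comment> \<open>\<open>u\<^sup>2 / \<pi> \<ge> 2 * u - \<pi>\<close>, because \<open>(u - \<pi>)\<^sup>2 \<ge> 0\<close>\<close>
  have sq: "?u z * p (t / 2) z a \<ge> \<pi> a * (2 * ?u z - \<pi> z)" if z: "z \<in> S" for z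
  proof -
    have "p (t / 2) z a = \<pi> a * ?u z / \<pi> z"
      using reversible[of "t / 2" a z] t a z pi_pos[OF z] by (simp add: field_simps)
    then have "?u z * p (t / 2) z a - \<pi> a * (2 * ?u z - \<pi> z) = \<pi> a * (?u z - \<pi> z)\<^sup>2 / \<pi> z"
      using pi_pos[OF z] by (simp add: field_simps power2_eq_square)
    also have "\<dots> \<ge> 0" using pi_pos[OF z] pi_pos[OF a] by simp
    finally show ?thesis by simp
  qed
  have "\<pi> a = (\<Sum>z\<in>S. \<pi> a * (2 * ?u z - \<pi> z))"
    using p_row[of "t / 2" a] t a pi_sum
    by (simp add: sum_distrib_left[symmetric] sum_subtractf)
  also have "\<dots> \<le> (\<Sum>z\<in>S. ?u z * p (t / 2) z a)"
    by (intro sum_mono sq)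
  also have "\<dots> = p t a a" using p_add[of "t / 2" "t / 2" a a] t a by simp
  finally show ?thesis .
qed

text \<open>A bottleneck bound. Mass leaves \<open>B\<close> at time \<open>s\<close> at rate
  \<open>\<Sum>y\<in>B. \<Sum>z\<in>S - B. p s x y * q y z\<close>, and \<open>p s x y \<le> \<pi> y / \<pi> x\<close> bounds this uniformly in \<open>s\<close> by
  the equilibrium flow out of \<open>B\<close>, inflated by \<open>1 / \<pi> x\<close>. Little is lost when \<open>x\<close>
  carries most of the mass of \<open>B\<close>.\<close>
lemma stay_prob_ge:
  assumes B: "B \<subseteq> S" and x: "x \<in> B" and t: "t \<ge> 0"
  shows "1 - t * ((\<Sum>y\<in>B. \<Sum>z\<in>S - B. \<pi> y * q y z) / \<pi> x) \<le> (\<Sum>y\<in>B. p t x y)"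
proof (cases "t = 0")
  case True
  then show ?thesis using x B finite_space
    by (subst sum.cong[OF refl, of B _ "\<lambda>y. if x = y then 1 else 0"])
       (auto simp: p_0 finite_subset subset_eq)
next
  case False
  with t have t: "0 < t" by simp
  let ?f = "indicator B :: _ \<Rightarrow> real"
  have xS: "x \<in> S" using x B by auto
  have qpos: "0 \<le> q y z" if "y \<in> S" "z \<in> S" "y \<noteq> z" for y z
  proof (rule tendsto_lowerbound)
    show "((\<lambda>h. p h y z / h) \<longlongrightarrow> q y z) (at_right 0)"
      using rates that by (simp add: has_transition_rates_def)
    show "\<forall>\<^sub>F h in at_right 0. 0 \<le> p h y z / h"
      by (rule eventually_at_right_less[THEN eventually_mono]) (simp add: p_nonneg that)
  qed simp
  have "\<exists>s\<in>{0<..<t}. evolve t ?f x - evolve 0 ?f x = evolve s (gen ?f) x * (t - 0)"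
    by (rule mvt_simple[OF t])
       (rule has_field_derivative_imp_has_derivative[OF DERIV_subset[OF forward_equation]],
        use xS in auto)
  then obtain s where s: "0 < s" and eq: "evolve t ?f x - 1 = evolve s (gen ?f) x * t"
    using x xS by (auto simp: evolve_0)
  have gB: "gen ?f y = - (\<Sum>z\<in>S - B. q y z)" if "y \<in> B" for y
  proof -
    have "gen ?f y = (\<Sum>z\<in>S - B. q y z * (?f z - ?f y))"
      unfolding gen_def using that finite_space by (intro sum.mono_neutral_right) auto
    also have "\<dots> = (\<Sum>z\<in>S - B. - q y z)" using that by (intro sum.cong) auto
    finally show ?thesis by (simp add: sum_negf)
  qed
  have gnB: "0 \<le> gen ?f y" if "y \<in> S - B" for y
    unfolding gen_def
  proof (rule sum_nonneg)
    fix z assume "z \<in> S"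
    then show "0 \<le> q y z * (?f z - ?f y)"
      using qpos[of y z] that by (cases "z = y") auto
  qed
  have "- ((\<Sum>y\<in>B. \<Sum>z\<in>S - B. \<pi> y * q y z) / \<pi> x) =
      (\<Sum>y\<in>B. \<pi> y / \<pi> x * gen ?f y)"
    by (simp add: gB sum_divide_distrib sum_negf sum_distrib_left)
  also have "\<dots> \<le> (\<Sum>y\<in>B. p s x y * gen ?f y)"
  proof (intro sum_mono mult_right_mono_neg)
    fix y assume "y \<in> B"
    then show "gen ?f y \<le> 0" "p s x y \<le> \<pi> y / \<pi> x"
      using B s xS qpos by (auto simp: gB intro!: sum_nonneg p_le_pi_ratio)
  qed
  also have "\<dots> \<le> evolve s (gen ?f) x"
    unfolding evolve_def using B finite_space s xS gnB
    by (intro sum_mono2) (auto intro!: mult_nonneg_nonneg p_nonneg)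
  finally have "- ((\<Sum>y\<in>B. \<Sum>z\<in>S - B. \<pi> y * q y z) / \<pi> x) * t \<le> evolve s (gen ?f) x * t"
    using t by (intro mult_right_mono) auto
  then show ?thesis using eq B by (simp add: evolve_indicator algebra_simps)
qed

text \<open>The mean hitting time of \<open>a\<close> is a function \<open>h\<close> of this kind. Along the chain, \<open>h\<close> decreases in mean at rate 1, except for what it regains at \<open>a\<close>; the regain is
  \<open>gen h a + 1 = 1 / \<pi> a\<close>, since \<open>gen h\<close> has \<open>\<pi>\<close>-mean 0. As \<open>h\<close> stays between 0 and \<open>H\<close>, it cannot
  decrease at rate more than \<open>1 / 2\<close> throughout \<open>[0, 2 * H]\<close>, so \<open>p s x a \<ge> \<pi> a / 2\<close> for some time
  \<open>s\<close> in this interval. From \<open>a\<close> the chain is again at \<open>a\<close> at the deterministic time \<open>2 * H\<close> with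
  probability at least \<open>\<pi> a\<close>.\<close>
lemma minorization:
  assumes a: "a \<in> S" and H: "0 < H"
    and h: "\<And>y. y \<in> S \<Longrightarrow> 0 \<le> h y \<and> h y \<le> H"
    and gen_h: "\<And>y. y \<in> S \<Longrightarrow> y \<noteq> a \<Longrightarrow> gen h y = -1"
    and x: "x \<in> S"
  shows "(\<pi> a)\<^sup>2 / 2 \<le> p (2 * H) x a"
proof -
  have pa: "0 < \<pi> a" using pi_pos[OF a] .
  have split: "(\<Sum>y\<in>S. w y * gen h y) = w a * (gen h a + 1) - (\<Sum>y\<in>S. w y)" for w
  proof -
    have "(\<Sum>y\<in>S - {a}. w y * gen h y) = - (\<Sum>y\<in>S - {a}. w y)"
      by (simp add: gen_h sum_negf)
    then show ?thesis
      using sum.remove[OF finite_space a, of "\<lambda>y. w y * gen h y"] sum.remove[OF finite_space a, of w]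
      by (simp add: algebra_simps)
  qed
  have ga: "gen h a + 1 = 1 / \<pi> a"
    using split[of \<pi>] pa by (simp add: sum_pi_gen pi_sum field_simps)
  have "\<exists>s\<in>{0<..<2 * H}. evolve (2 * H) h x - evolve 0 h x = evolve s (gen h) x * (2 * H - 0)"
    by (rule mvt_simple)
       (use H in simp, rule has_field_derivative_imp_has_derivative[OF DERIV_subset[OF forward_equation]],
        use x in auto)
  then obtain s where s: "0 < s" "s < 2 * H"
    and eq: "evolve (2 * H) h x - h x = evolve s (gen h) x * (2 * H)"
    using x by (auto simp: evolve_0)
  have "evolve s (gen h) x = p s x a / \<pi> a - 1"
    using split[of "p s x"] s x by (simp add: evolve_def p_row ga)
  moreover have "0 \<le> evolve (2 * H) h x"
    unfolding evolve_def using h H x by (auto intro!: sum_nonneg mult_nonneg_nonneg p_nonneg)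
  then have "- H \<le> evolve s (gen h) x * (2 * H)"
    using eq h[OF x] by linarith
  ultimately have "- H \<le> (p s x a / \<pi> a - 1) * (2 * H)" by simp
  then have "(-1) * H \<le> (2 * (p s x a / \<pi> a - 1)) * H" by (simp add: algebra_simps)
  then have "-1 \<le> 2 * (p s x a / \<pi> a - 1)" by (rule mult_right_le_imp_le[OF _ H])
  then have "\<pi> a / 2 \<le> p s x a" using pa by (simp add: field_simps)
  then have "\<pi> a / 2 * \<pi> a \<le> p s x a * p (2 * H - s) a a"
    using return_prob_ge[OF _ a, of "2 * H - s"] s pa p_nonneg[of s x a] x a
    by (intro mult_mono) auto
  also have "\<dots> \<le> (\<Sum>z\<in>S. p s x z * p (2 * H - s) z a)"
    using s x a by (intro member_le_sum[OF a, of "\<lambda>z. p s x z * p (2 * H - s) z a"] finite_space)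
      (auto intro!: mult_nonneg_nonneg p_nonneg)
  also have "\<dots> = p (2 * H) x a" using p_add[of s "2 * H - s" x a] s x a by simp
  finally show ?thesis by (simp add: power2_eq_square)
qed

text \<open>Doeblin's argument. The stationary mass of \<open>A\<close> is a \<open>\<pi>\<close>-average of the transition
  probabilities into \<open>A\<close>, so it lies in the same interval of length \<open>(1 - c) ^ n\<close> as all of them.\<close>
lemma geometric_convergence:
  assumes minor: "\<And>x. x \<in> S \<Longrightarrow> c \<le> p t x a"
    and t: "t \<ge> 0" and a: "a \<in> S" and x: "x \<in> S" and A: "A \<subseteq> S"
  shows "\<bar>(\<Sum>y\<in>A. p (real n * t) x y) - (\<Sum>y\<in>A. \<pi> y)\<bar> \<le> (1 - c) ^ n"
proof -
  let ?T = "real n * t" and ?f = "indicator A :: _ \<Rightarrow> real"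
  obtain m where m: "\<And>z. z \<in> S \<Longrightarrow> m \<le> evolve ?T ?f z \<and> evolve ?T ?f z \<le> m + (1 - c) ^ n"
    using oscillation_contracts[OF minor t a, of ?f n] by (auto simp: indicator_def)
  have eq: "(\<Sum>y\<in>A. \<pi> y) = (\<Sum>z\<in>S. \<pi> z * evolve ?T ?f z)"
  proof -
    have "(\<Sum>z\<in>S. \<pi> z * ?f z) = (\<Sum>y\<in>A. \<pi> y)"
      using A finite_space by (intro sum.mono_neutral_cong_right) (auto simp: indicator_def)
    then show ?thesis using evolve_stationary[of ?T ?f] t by simp
  qed
  have "(\<Sum>z\<in>S. \<pi> z * m) \<le> (\<Sum>z\<in>S. \<pi> z * evolve ?T ?f z)"
    "(\<Sum>z\<in>S. \<pi> z * evolve ?T ?f z) \<le> (\<Sum>z\<in>S. \<pi> z * (m + (1 - c) ^ n))"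
    using m pi_pos by (auto intro!: sum_mono mult_left_mono simp: less_imp_le)
  then have "m \<le> (\<Sum>y\<in>A. \<pi> y)" "(\<Sum>y\<in>A. \<pi> y) \<le> m + (1 - c) ^ n"
    by (simp_all add: eq sum_distrib_right[symmetric] pi_sum)
  then show ?thesis
    using m[OF x] A by (simp add: evolve_indicator abs_le_iff)
qed

end

section \<open>Laws of Markov processes and mixing times\<close>

text \<open>The semigroup is part of the existential content of the definition and may depend on the
  start \<open>x\<close>; the later bounds therefore hold for every semigroup with the given rates.\<close>
lemma markov_process_law:
  assumes mp: "markov_process M S q x X" and S: "finite S" and x: "x \<in> S"
  obtains p where "transition_function S p" "has_transition_rates S q p"
    "\<And>t A. t \<ge> 0 \<Longrightarrow> A \<subseteq> S \<Longrightarrow> measure (distr M (count_space S) (X t)) A = (\<Sum>y\<in>A. p t x y)"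
proof -
  interpret prob_space M using mp by (simp add: markov_process_def)
  have meas: "X t \<in> measurable M (count_space S)" if "t \<ge> 0" for t
    using mp that by (simp add: markov_process_def)
  have start: "AE \<omega> in M. X 0 \<omega> = x" using mp by (simp add: markov_process_def)
  obtain p where p: "transition_function S p" "has_transition_rates S q p"
    and cond: "\<And>(n::nat) t i y. y \<in> S \<Longrightarrow> 0 \<le> t 0 \<Longrightarrow> strict_mono_on {..Suc n} t \<Longrightarrow>
       0 < \<P>(\<omega> in M. \<forall>m\<le>n. X (t m) \<omega> = i m) \<Longrightarrow>
       \<P>(\<omega> in M. X (t (Suc n)) \<omega> = y \<bar> \<forall>m\<le>n. X (t m) \<omega> = i m) = p (t (Suc n) - t n) (i n) y"
    using mp unfolding markov_process_def by blast
  have sets: "{\<omega> \<in> space M. X t \<omega> = y} \<in> sets M" if "t \<ge> 0" for t y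
  proof (cases "y \<in> S")
    case True
    then have "X t -` {y} \<inter> space M \<in> sets M" using meas[OF that] by (intro measurable_sets) auto
    moreover have "X t -` {y} \<inter> space M = {\<omega> \<in> space M. X t \<omega> = y}" by auto
    ultimately show ?thesis by simp
  next
    case False
    then have "{\<omega> \<in> space M. X t \<omega> = y} = {}"
      using measurable_space[OF meas[OF that]] by auto
    then show ?thesis by (simp only: sets.empty_sets)
  qed
  have start_prob: "\<P>(\<omega> in M. X 0 \<omega> = x) = 1"
    using prob_Collect_eq_1[OF sets, of 0 x] start by simp
  have law: "\<P>(\<omega> in M. X t \<omega> = y) = p t x y" if t: "t \<ge> 0" and y: "y \<in> S" for t y
  proof (cases "t = 0")
    case True
    have "\<P>(\<omega> in M. X 0 \<omega> = y) = 0" if "x \<noteq> y"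
    proof -
      have "AE \<omega> in M. X 0 \<omega> \<noteq> y" using start by eventually_elim (use that in auto)
      then show ?thesis using prob_Collect_eq_0[OF sets, of 0 y] by simp
    qed
    then show ?thesis
      using True start_prob p(1) x y by (auto simp: transition_function_def)
  next
    case False
    \<comment> \<open>one step of the Markov property, conditioned on the almost sure event \<open>X 0 = x\<close>\<close>
    let ?t = "\<lambda>m::nat. if m = 0 then 0 else t"
    have "strict_mono_on {..Suc 0} ?t"
      using False t by (auto simp: strict_mono_on_def)
    then have "\<P>(\<omega> in M. X t \<omega> = y \<bar> X 0 \<omega> = x) = p t x y"
      using cond[of y ?t 0 "\<lambda>_. x"] y start_prob by simp
    then have "\<P>(\<omega> in M. X t \<omega> = y \<and> X 0 \<omega> = x) = p t x y"
      by (simp add: cond_prob_def start_prob)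
    moreover have "{\<omega> \<in> space M. X t \<omega> = y \<and> X 0 \<omega> = x} \<in> sets M"
    proof -
      have "{\<omega> \<in> space M. X t \<omega> = y \<and> X 0 \<omega> = x} =
          {\<omega> \<in> space M. X t \<omega> = y} \<inter> {\<omega> \<in> space M. X 0 \<omega> = x}" by auto
      then show ?thesis using sets t by auto
    qed
    then have "\<P>(\<omega> in M. X t \<omega> = y \<and> X 0 \<omega> = x) = \<P>(\<omega> in M. X t \<omega> = y)"
      using start t by (intro finite_measure_eq_AE) (auto simp: sets)
    ultimately show ?thesis by simp
  qed
  show ?thesis
  proof (rule that[OF p])
    fix t :: real and A assume t: "t \<ge> 0" and A: "A \<subseteq> S"
    interpret D: prob_space "distr M (count_space S) (X t)"
      using prob_space_distr[OF meas[OF t]] .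
    have "measure (distr M (count_space S) (X t)) A =
        (\<Sum>y\<in>A. measure (distr M (count_space S) (X t)) {y})"
      using A S finite_subset by (intro D.finite_measure_eq_sum_singleton) auto
    also have "\<dots> = (\<Sum>y\<in>A. p t x y)"
    proof (rule sum.cong[OF refl])
      fix y assume "y \<in> A"
      then have y: "y \<in> S" using A by auto
      then have "measure (distr M (count_space S) (X t)) {y} = measure M (X t -` {y} \<inter> space M)"
        using meas[OF t] by (intro measure_distr) auto
      also have "X t -` {y} \<inter> space M = {\<omega> \<in> space M. X t \<omega> = y}" by auto
      finally show "measure (distr M (count_space S) (X t)) {y} = p t x y"
        using law[OF t y] by simp
    qed
    finally show "measure (distr M (count_space S) (X t)) A = (\<Sum>y\<in>A. p t x y)" .
  qed
qed

lemma tv_dist_le_iff: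
  assumes "finite S"
  shows "tv_dist S \<mu> \<mu>' \<le> e \<longleftrightarrow> (\<forall>A\<subseteq>S. \<bar>measure \<mu> A - measure \<mu>' A\<bar> \<le> e)"
  unfolding tv_dist_def using assms by (subst Max_le_iff) auto

lemma max_tv_dist_le_iff:
  assumes "finite S" "S \<noteq> {}"
  shows "max_tv_dist S M X \<mu> t \<le> e \<longleftrightarrow>
    (\<forall>x\<in>S. \<forall>A\<subseteq>S. \<bar>measure (distr (M x) (count_space S) (X x t)) A - measure \<mu> A\<bar> \<le> e)"
  unfolding max_tv_dist_def using assms by (subst Max_le_iff) (auto simp: tv_dist_le_iff)

lemma measure_point_measure:
  assumes "finite S" "A \<subseteq> S" "\<And>x. x \<in> S \<Longrightarrow> 0 \<le> f x"
  shows "measure (point_measure S (\<lambda>x. ennreal (f x))) A = (\<Sum>x\<in>A. f x)"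
proof -
  have "emeasure (point_measure S (\<lambda>x. ennreal (f x))) A = ennreal (\<Sum>x\<in>A. f x)"
    using assms finite_subset[of A S]
    by (subst emeasure_point_measure_finite2) (auto intro!: sum_ennreal)
  then show ?thesis using assms
    by (simp add: measure_def sum_nonneg subset_eq)
qed

section \<open>The stationary distribution of the star\<close>

lemma star_space_eq:
  "star_space K L = insert Center (\<Union>k\<in>{1..K}. Branch k ` {1..L k})"
  by (auto simp: star_space_def)

lemma finite_star_space: "finite (star_space K L)"
  by (simp add: star_space_eq)

lemma Center_in_star_space [simp]: "Center \<in> star_space K L"
  and Branch_in_star_space [simp]:
    "Branch k l \<in> star_space K L \<longleftrightarrow> 1 \<le> k \<and> k \<le> K \<and> 1 \<le> l \<and> l \<le> L k"
  by (auto simp: star_space_def)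

lemma sum_star_space:
  "(\<Sum>x\<in>star_space K L. f x) = f Center + (\<Sum>k=1..K. \<Sum>l=1..L k. f (Branch k l))"
proof -
  have "(\<Sum>x\<in>(\<Union>k\<in>{1..K}. Branch k ` {1..L k}). f x) =
      (\<Sum>k=1..K. \<Sum>x\<in>Branch k ` {1..L k}. f x)"
    by (intro sum.UNION_disjoint) auto
  also have "\<dots> = (\<Sum>k=1..K. \<Sum>l=1..L k. f (Branch k l))"
    by (intro sum.cong refl) (simp add: sum.reindex inj_on_def)
  finally show ?thesis
    unfolding star_space_eq by (subst sum.insert) auto
qed

definition star_weight :: "(nat \<Rightarrow> nat) \<Rightarrow> real \<Rightarrow> nat \<Rightarrow> nat \<Rightarrow> real" where
  "star_weight L \<nu> k l = real (L k choose l) * \<nu> ^ l"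

definition star_tail :: "(nat \<Rightarrow> nat) \<Rightarrow> real \<Rightarrow> nat \<Rightarrow> nat \<Rightarrow> real" where
  "star_tail L \<nu> k l = (\<Sum>j=l..L k. star_weight L \<nu> k j)"

definition star_total :: "nat \<Rightarrow> (nat \<Rightarrow> nat) \<Rightarrow> real \<Rightarrow> real" where
  "star_total K L \<nu> = 1 + (\<Sum>k=1..K. star_tail L \<nu> k 1)"

lemma star_pi_eq:
  "star_pi K L \<nu> Center = 1 / star_total K L \<nu>"
  "star_pi K L \<nu> (Branch k l) = star_weight L \<nu> k l / star_total K L \<nu>"
  by (simp_all add: star_pi0_def star_total_def star_tail_def star_weight_def divide_inverse mult_ac)

lemma star_weight_pos: "\<nu> > 0 \<Longrightarrow> l \<le> L k \<Longrightarrow> 0 < star_weight L \<nu> k l"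
  by (simp add: star_weight_def)

lemma star_tail_nonneg: "\<nu> > 0 \<Longrightarrow> 0 \<le> star_tail L \<nu> k l"
  unfolding star_tail_def by (rule sum_nonneg) (auto intro: less_imp_le[OF star_weight_pos])

lemma star_total_ge_1: "\<nu> > 0 \<Longrightarrow> 1 \<le> star_total K L \<nu>"
  by (simp add: star_total_def sum_nonneg star_tail_nonneg)

lemma star_tail_Suc: "l \<le> L k \<Longrightarrow> star_tail L \<nu> k l = star_weight L \<nu> k l + star_tail L \<nu> k (Suc l)"
  by (simp add: star_tail_def sum.atLeast_Suc_atMost)

lemma star_weight_rate:
  assumes "l < L k"
  shows "star_weight L \<nu> k l * ((real (L k) - real l) * \<nu>) = real (Suc l) * star_weight L \<nu> k (Suc l)"
proof -
  have "(L k choose l) * (L k - l) = (L k choose Suc l) * Suc l"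
    using assms binomial_absorb_comp[of "L k" l] Suc_times_binomial_eq[of "L k - 1" l]
    by (cases "L k") (auto simp: mult.commute)
  then have "real (L k choose l) * (real (L k) - real l) = real (L k choose Suc l) * real (Suc l)"
    using assms by (metis of_nat_mult of_nat_diff less_imp_le)
  then show ?thesis by (simp add: star_weight_def algebra_simps)
qed

lemma star_tail_1_eq: "star_tail L \<nu> k 1 = (1 + \<nu>) ^ L k - 1"
proof -
  have "(1 + \<nu>) ^ L k = star_tail L \<nu> k 0"
    using binomial_ring[of \<nu> 1 "L k"]
    by (simp add: star_tail_def star_weight_def atMost_atLeast0 add.commute)
  then show ?thesis using star_tail_Suc[of 0 L k] by (simp add: star_weight_def)
qed

lemma star_pi_branch: "(\<Sum>y\<in>Branch k ` {1..L k}. star_pi K L \<nu> y) = star_tail L \<nu> k 1 / star_total K L \<nu>"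
  by (subst sum.reindex) (auto simp: inj_on_def star_pi_eq star_tail_def sum_divide_distrib simp del: star_pi.simps)

lemma star_reversible_semigroup:
  assumes "\<nu> > 0" "transition_function (star_space K L) p"
    "has_transition_rates (star_space K L) (star_rate L \<nu>) p"
  shows "reversible_semigroup (star_space K L) (star_rate L \<nu>) p (star_pi K L \<nu>)"
proof
  show "0 < star_pi K L \<nu> x" if "x \<in> star_space K L" for x
    using that assms(1) star_total_ge_1[OF assms(1), of K L]
    by (cases x) (auto simp: star_pi_eq star_weight_pos simp del: star_pi.simps)
  have "(\<Sum>x\<in>star_space K L. star_pi K L \<nu> x) = star_total K L \<nu> / star_total K L \<nu>"
    by (simp only: sum_star_space star_pi_eq sum_divide_distrib[symmetric]
        add_divide_distrib[symmetric] star_total_def star_tail_def)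
  then show "(\<Sum>x\<in>star_space K L. star_pi K L \<nu> x) = 1"
    using star_total_ge_1[OF assms(1), of K L] by simp
qed (use assms finite_star_space star_pi_detailed_balance in auto)

section \<open>Mean hitting times of the tip of the longest branch\<close>

text \<open>The difference of the mean hitting times of the tip \<open>Branch 1 (L 1)\<close> from levels \<open>l\<close> and
  \<open>l - 1\<close> of branch \<open>k\<close>. On a tree, the mean time to cross an edge from one side is the stationary
  mass of that side divided by the equilibrium flow through the edge, here \<open>l\<close> times the weight of
  level \<open>l\<close>. On branch 1 the tip lies outwards, so the relevant side is the complement of the tail, and
  the sign is reversed.\<close>
definition hitting_increment :: "nat \<Rightarrow> (nat \<Rightarrow> nat) \<Rightarrow> real \<Rightarrow> nat \<Rightarrow> nat \<Rightarrow> real" where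
  "hitting_increment K L \<nu> k l =
     (star_tail L \<nu> k l - (if k = 1 then star_total K L \<nu> else 0)) / (real l * star_weight L \<nu> k l)"

text \<open>Normalized so that the hitting time vanishes at the tip of branch 1.\<close>
definition center_hitting_time :: "nat \<Rightarrow> (nat \<Rightarrow> nat) \<Rightarrow> real \<Rightarrow> real" where
  "center_hitting_time K L \<nu> = - (\<Sum>j=1..L 1. hitting_increment K L \<nu> 1 j)"

fun mean_hitting_time :: "nat \<Rightarrow> (nat \<Rightarrow> nat) \<Rightarrow> real \<Rightarrow> star_state \<Rightarrow> real" where
  "mean_hitting_time K L \<nu> Center = center_hitting_time K L \<nu>"
| "mean_hitting_time K L \<nu> (Branch k l) = center_hitting_time K L \<nu> + (\<Sum>j=1..l. hitting_increment K L \<nu> k j)"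

text \<open>Restricting to \<open>\<nu> \<ge> 1\<close> makes powers of \<open>\<nu>\<close> increase with the exponent, so that all
  estimates are comparisons of exponents.\<close>
locale fast_star =
  fixes K :: nat and L :: "nat \<Rightarrow> nat" and \<nu> :: real
  assumes K: "K \<ge> 2"
    and L_pos: "\<And>k. 1 \<le> k \<Longrightarrow> k \<le> K \<Longrightarrow> L k \<ge> 1"
    and L_mono: "\<And>j k. 1 \<le> j \<Longrightarrow> j \<le> k \<Longrightarrow> k \<le> K \<Longrightarrow> L k \<le> L j"
    and nu: "\<nu> \<ge> 1"
begin

lemma hitting_increment_mult:
  assumes "1 \<le> l" "l \<le> L k"
  shows "real l * star_weight L \<nu> k l * hitting_increment K L \<nu> k l = star_tail L \<nu> k l - (if k = 1 then star_total K L \<nu> else 0)"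
proof -
  have "real l * star_weight L \<nu> k l \<noteq> 0" using assms nu star_weight_pos[of \<nu> l L k] by auto
  then show ?thesis by (simp add: hitting_increment_def)
qed

text \<open>Multiplied by the weight of a state, the generator is the difference of the flows through its
  edges. By the choice of the increments these flows are tails (minus the total mass on branch 1), and
  consecutive tails differ by exactly the weight of the state between them.\<close>
lemma mean_hitting_time_generator:
  assumes x: "x \<in> star_space K L" and "x \<noteq> Branch 1 (L 1)"
  shows "(\<Sum>y\<in>star_space K L. star_rate L \<nu> x y * (mean_hitting_time K L \<nu> y - mean_hitting_time K L \<nu> x)) = -1"
proof (cases x)
  case Center
  have "(\<Sum>y\<in>star_space K L. star_rate L \<nu> x y * (mean_hitting_time K L \<nu> y - mean_hitting_time K L \<nu> x)) =
      (\<Sum>k=1..K. \<Sum>l=1..L k. if l = 1 then real (L k) * \<nu> * hitting_increment K L \<nu> k 1 else 0)"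
  proof -
    have "star_rate L \<nu> Center (Branch k l) * (mean_hitting_time K L \<nu> (Branch k l) - mean_hitting_time K L \<nu> Center) =
        (if l = 1 then real (L k) * \<nu> * hitting_increment K L \<nu> k 1 else 0)" for k l by simp
    then show ?thesis by (simp only: sum_star_space Center) simp
  qed
  also have "\<dots> = (\<Sum>k=1..K. real (L k) * \<nu> * hitting_increment K L \<nu> k 1)"
    using L_pos by (intro sum.cong refl) (simp add: Suc_le_eq)
  also have "\<dots> = (\<Sum>k=1..K. star_tail L \<nu> k 1 - (if k = 1 then star_total K L \<nu> else 0))"
    using hitting_increment_mult[of 1] L_pos by (intro sum.cong refl) (simp add: star_weight_def)
  also have "\<dots> = -1"
    using K by (simp add: sum_subtractf star_total_def)
  finally show ?thesis .
next
  case (Branch k l)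
  let ?h = "mean_hitting_time K L \<nu>" and ?S = "star_space K L"
  have kl: "1 \<le> k" "k \<le> K" "1 \<le> l" "l \<le> L k" using x Branch by auto
  let ?down = "if l = 1 then Center else Branch k (l - 1)"
  have down_h: "?h ?down - ?h (Branch k l) = - hitting_increment K L \<nu> k l"
    using kl sum.nat_ivl_Suc'[of 1 "l - 1" "hitting_increment K L \<nu> k"] by (cases l) auto
  have down_q: "star_rate L \<nu> (Branch k l) ?down = real l" using kl by auto
  have down_S: "?down \<in> ?S" using kl by auto
  let ?e = "if k = 1 then star_total K L \<nu> else 0"
  have w: "0 < star_weight L \<nu> k l" using kl nu by (intro star_weight_pos) auto
  have "star_weight L \<nu> k l * (\<Sum>y\<in>?S. star_rate L \<nu> x y * (?h y - ?h x)) = - star_weight L \<nu> k l"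
  proof (cases "l = L k")
    case True
    have "(\<Sum>y\<in>?S. star_rate L \<nu> x y * (?h y - ?h x)) =
        (\<Sum>y\<in>{?down}. star_rate L \<nu> x y * (?h y - ?h x))"
    proof (intro sum.mono_neutral_right finite_star_space ballI)
      fix y assume "y \<in> ?S - {?down}"
      then show "star_rate L \<nu> x y * (?h y - ?h x) = 0"
        using True Branch by (cases y) (auto split: if_splits)
    qed (use down_S in auto)
    also have "\<dots> = real l * (- hitting_increment K L \<nu> k l)"
      using down_h down_q Branch by simp
    finally have "star_weight L \<nu> k l * (\<Sum>y\<in>?S. star_rate L \<nu> x y * (?h y - ?h x)) =
      - (star_tail L \<nu> k l - ?e)"
      using hitting_increment_mult[of l k] kl by (simp add: algebra_simps)
    moreover have "k \<noteq> 1" using True assms(2) Branch by auto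
    moreover have "star_tail L \<nu> k l = star_weight L \<nu> k l" using True by (simp add: star_tail_def)
    ultimately show ?thesis by simp
  next
    case False
    with kl have less: "l < L k" by simp
    have "(\<Sum>y\<in>?S. star_rate L \<nu> x y * (?h y - ?h x)) =
        (\<Sum>y\<in>{?down, Branch k (Suc l)}. star_rate L \<nu> x y * (?h y - ?h x))"
    proof (intro sum.mono_neutral_right finite_star_space ballI)
      fix y assume "y \<in> ?S - {?down, Branch k (Suc l)}"
      then show "star_rate L \<nu> x y * (?h y - ?h x) = 0"
        using Branch by (cases y) (auto split: if_splits)
    qed (use down_S less kl in auto)
    also have "\<dots> = real l * (- hitting_increment K L \<nu> k l) +
        (real (L k) - real l) * \<nu> * hitting_increment K L \<nu> k (Suc l)"
      using down_h down_q Branch kl by (subst sum.insert) auto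
    finally have eq: "(\<Sum>y\<in>?S. star_rate L \<nu> x y * (?h y - ?h x)) = \<dots>" .
    have "star_weight L \<nu> k l * (\<Sum>y\<in>?S. star_rate L \<nu> x y * (?h y - ?h x)) =
      - (real l * star_weight L \<nu> k l * hitting_increment K L \<nu> k l) +
      star_weight L \<nu> k l * ((real (L k) - real l) * \<nu>) * hitting_increment K L \<nu> k (Suc l)"
      unfolding eq by (simp add: algebra_simps)
    also have "\<dots> = - (star_tail L \<nu> k l - ?e) + (star_tail L \<nu> k (Suc l) - ?e)"
      unfolding star_weight_rate[of l L k, OF less] hitting_increment_mult[OF kl(3,4)]
      using hitting_increment_mult[of "Suc l" k] less by simp
    finally show ?thesis using star_tail_Suc[of l L k] kl by simp
  qed
  then have "star_weight L \<nu> k l * (\<Sum>y\<in>?S. star_rate L \<nu> x y * (?h y - ?h x)) =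
    star_weight L \<nu> k l * (-1)" by simp
  then show ?thesis using w mult_left_cancel by (metis less_irrefl)
qed

lemma sum_weight_le:
  assumes A: "A \<subseteq> {..L k}" and n: "\<And>j. j \<in> A \<Longrightarrow> j \<le> n"
  shows "(\<Sum>j\<in>A. star_weight L \<nu> k j) \<le> 2 ^ L k * \<nu> ^ n"
proof -
  have "(\<Sum>j\<in>A. star_weight L \<nu> k j) \<le> (\<Sum>j\<in>A. real (L k choose j) * \<nu> ^ n)"
    unfolding star_weight_def using n nu by (intro sum_mono mult_left_mono power_increasing) auto
  also have "\<dots> \<le> (\<Sum>j\<le>L k. real (L k choose j) * \<nu> ^ n)"
    using A nu by (intro sum_mono2) auto
  also have "\<dots> = 2 ^ L k * \<nu> ^ n"
    using choose_row_sum[of "L k"]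
    by (simp add: sum_distrib_right[symmetric] flip: of_nat_sum)
  finally show ?thesis .
qed

lemma star_tail_le: "1 \<le> k \<Longrightarrow> k \<le> K \<Longrightarrow> star_tail L \<nu> k l \<le> 2 ^ L 1 * \<nu> ^ L k"
proof -
  assume k: "1 \<le> k" "k \<le> K"
  have "star_tail L \<nu> k l \<le> 2 ^ L k * \<nu> ^ L k"
    unfolding star_tail_def by (rule sum_weight_le) auto
  also have "\<dots> \<le> 2 ^ L 1 * \<nu> ^ L k"
    using L_mono[of 1 k] k nu by (intro mult_right_mono power_increasing) auto
  finally show ?thesis .
qed

lemma star_total_le: "star_total K L \<nu> \<le> (1 + real K * 2 ^ L 1) * \<nu> ^ L 1"
proof -
  have "star_tail L \<nu> k 1 \<le> 2 ^ L 1 * \<nu> ^ L 1" if "k \<in> {1..K}" for k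
  proof -
    have "2 ^ L 1 * \<nu> ^ L k \<le> 2 ^ L 1 * \<nu> ^ L 1"
      using L_mono[of 1 k] that nu by (intro mult_left_mono power_increasing) auto
    then show ?thesis using star_tail_le[of k 1] that by (intro order_trans[OF star_tail_le]) auto
  qed
  then have "(\<Sum>k=1..K. star_tail L \<nu> k 1) \<le> real K * (2 ^ L 1 * \<nu> ^ L 1)"
    using sum_bounded_above[of "{1..K}" "\<lambda>k. star_tail L \<nu> k 1" "2 ^ L 1 * \<nu> ^ L 1"] by simp
  moreover have "1 \<le> \<nu> ^ L 1" using nu by simp
  ultimately show ?thesis by (simp add: star_total_def algebra_simps)
qed

lemma star_pi_target_ge: "1 / (1 + real K * 2 ^ L 1) \<le> star_pi K L \<nu> (Branch 1 (L 1))"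
proof -
  have c: "0 < 1 + real K * 2 ^ L 1" by (simp add: add_pos_nonneg)
  have "0 < star_total K L \<nu>" using star_total_ge_1[of \<nu> K L] nu by simp
  then show ?thesis using star_total_le c
    unfolding star_pi_eq by (simp add: star_weight_def divide_simps mult.commute)
qed

text \<open>The mass on the inner side of an edge of branch 1 consists of the levels below \<open>l\<close> of branch 1 and
  of the other branches, each of size at most \<open>L 2\<close>. Here the exponent \<open>L 2\<close> of the mixing time enters:
  however large \<open>L 1\<close> is, it contributes to the mass only through levels below \<open>l\<close>.\<close>
lemma off_target_le:
  assumes l: "1 \<le> l" "l \<le> L 1"
  shows "star_total K L \<nu> - star_tail L \<nu> 1 l \<le> (real K + 1) * 2 ^ L 1 * \<nu> ^ (L 2 - 1 + l)"
proof -
  have "(\<Sum>j<l. star_weight L \<nu> 1 j) + star_tail L \<nu> 1 l = 1 + star_tail L \<nu> 1 1"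
  proof -
    have "(\<Sum>j<l. star_weight L \<nu> 1 j) + star_tail L \<nu> 1 l = star_tail L \<nu> 1 0"
      unfolding star_tail_def using l
      by (subst sum.union_disjoint[symmetric]) (auto intro!: sum.cong)
    then show ?thesis using star_tail_Suc[of 0 L 1] by (simp add: star_weight_def)
  qed
  moreover have "(\<Sum>k=1..K. star_tail L \<nu> k 1) = star_tail L \<nu> 1 1 + (\<Sum>k=2..K. star_tail L \<nu> k 1)"
    using K by (subst sum.atLeast_Suc_atMost) (auto simp: numeral_2_eq_2)
  ultimately have eq: "star_total K L \<nu> - star_tail L \<nu> 1 l =
      (\<Sum>j<l. star_weight L \<nu> 1 j) + (\<Sum>k=2..K. star_tail L \<nu> k 1)"
    by (simp add: star_total_def)
  let ?P = "2 ^ L 1 * \<nu> ^ (L 2 - 1 + l)"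
  have "(\<Sum>j<l. star_weight L \<nu> 1 j) \<le> ?P"
    using l by (intro sum_weight_le) auto
  moreover have "(\<Sum>k=2..K. star_tail L \<nu> k 1) \<le> real (card {2..K}) * ?P"
  proof (rule sum_bounded_above)
    fix k assume k: "k \<in> {2..K}"
    have "star_tail L \<nu> k 1 \<le> 2 ^ L 1 * \<nu> ^ L k" using k by (intro star_tail_le) auto
    also have "\<dots> \<le> ?P"
      using k l L_mono[of 2 k] L_pos[of 2] K nu
      by (intro mult_left_mono power_increasing) auto
    finally show "star_tail L \<nu> k 1 \<le> ?P" .
  qed
  moreover have "real (card {2..K}) * ?P \<le> real K * ?P"
    using nu K by (intro mult_right_mono) auto
  moreover have "(real K + 1) * 2 ^ L 1 * \<nu> ^ (L 2 - 1 + l) = ?P + real K * ?P"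
    by (simp add: algebra_simps)
  ultimately show ?thesis unfolding eq by linarith
qed

lemma hitting_increment_bounds:
  assumes k: "1 \<le> k" "k \<le> K" and l: "1 \<le> l" "l \<le> L k"
  defines "G \<equiv> (real K + 1) * 2 ^ L 1 * \<nu> ^ (L 2 - 1)"
  shows "k = 1 \<Longrightarrow> - G \<le> hitting_increment K L \<nu> k l \<and> hitting_increment K L \<nu> k l \<le> 0"
    and "k \<noteq> 1 \<Longrightarrow> 0 \<le> hitting_increment K L \<nu> k l \<and> hitting_increment K L \<nu> k l \<le> G"
proof -
  define d where "d = real l * star_weight L \<nu> k l"
  have inc: "hitting_increment K L \<nu> k l =
      (star_tail L \<nu> k l - (if k = 1 then star_total K L \<nu> else 0)) / d"
    by (simp add: d_def hitting_increment_def)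
  have d_ge: "\<nu> ^ l \<le> d"
  proof -
    have "1 \<le> l * (L k choose l)" using l by (simp add: Suc_le_eq)
    then have "1 \<le> real l * real (L k choose l)" by (metis of_nat_mult of_nat_le_iff of_nat_1)
    then show ?thesis using mult_right_mono[of 1 "real l * real (L k choose l)" "\<nu> ^ l"] nu
      by (simp add: d_def star_weight_def)
  qed
  have "0 < \<nu> ^ l" using nu by simp
  then have d: "0 < d" using d_ge by linarith
  have G: "0 \<le> G" using nu by (simp add: G_def)
  have Gd: "G * \<nu> ^ l \<le> G * d" using d_ge G by (rule mult_left_mono)
  have Geq: "G * \<nu> ^ l = (real K + 1) * 2 ^ L 1 * \<nu> ^ (L 2 - 1 + l)"
    by (simp add: G_def power_add)
  show "- G \<le> hitting_increment K L \<nu> k l \<and> hitting_increment K L \<nu> k l \<le> 0" if "k = 1"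
  proof -
    have "star_total K L \<nu> - star_tail L \<nu> 1 l \<le> G * d"
      using off_target_le[of l] l that Gd Geq by simp
    moreover have "star_tail L \<nu> 1 l \<le> star_total K L \<nu>"
    proof -
      have "star_tail L \<nu> 1 l \<le> star_tail L \<nu> 1 1"
        unfolding star_tail_def using l nu star_weight_pos[of \<nu> _ L 1]
        by (intro sum_mono2) (auto intro!: less_imp_le)
      also have "\<dots> \<le> (\<Sum>k=1..K. star_tail L \<nu> k 1)"
        using K nu by (intro member_le_sum) (auto intro!: star_tail_nonneg)
      finally show ?thesis by (simp add: star_total_def)
    qed
    moreover have i: "hitting_increment K L \<nu> 1 l = (star_tail L \<nu> 1 l - star_total K L \<nu>) / d"
      using inc that by simp
    ultimately show ?thesis
      using d unfolding that i by (simp add: divide_simps)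
  qed
  show "0 \<le> hitting_increment K L \<nu> k l \<and> hitting_increment K L \<nu> k l \<le> G" if "k \<noteq> 1"
  proof -
    have "star_tail L \<nu> k l \<le> 2 ^ L 1 * \<nu> ^ L k" using k by (rule star_tail_le)
    also have "\<dots> \<le> 2 ^ L 1 * \<nu> ^ (L 2 - 1 + l)"
      using k l L_mono[of 2 k] that nu by (intro mult_left_mono power_increasing) auto
    also have "\<dots> \<le> (real K + 1) * (2 ^ L 1 * \<nu> ^ (L 2 - 1 + l))"
      using nu by (simp add: algebra_simps)
    also have "\<dots> \<le> G * d" using Gd Geq by (simp add: mult.assoc)
    finally show ?thesis
      using that d star_tail_nonneg[of \<nu> L k l] nu by (simp add: inc pos_divide_le_eq)
  qed
qed

lemma mean_hitting_time_bounds: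
  assumes x: "x \<in> star_space K L"
  defines "G \<equiv> (real K + 1) * 2 ^ L 1 * \<nu> ^ (L 2 - 1)"
  shows "0 \<le> mean_hitting_time K L \<nu> x" "mean_hitting_time K L \<nu> x \<le> 2 * real (L 1) * G"
proof -
  let ?i = "hitting_increment K L \<nu>"
  have G: "0 \<le> G" using nu by (simp add: G_def)
  have one: "- G \<le> ?i 1 l" "?i 1 l \<le> 0" if "l \<in> {1..L 1}" for l
    using hitting_increment_bounds(1)[of 1 l] that K by (auto simp: G_def)
  have c0: "0 \<le> center_hitting_time K L \<nu>"
    unfolding center_hitting_time_def using one by (auto intro!: sum_nonpos)
  have "(\<Sum>j=1..L 1. - G) \<le> (\<Sum>j=1..L 1. ?i 1 j)" using one by (intro sum_mono) auto
  then have c1: "center_hitting_time K L \<nu> \<le> real (L 1) * G" by (simp add: center_hitting_time_def)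
  have LG: "0 \<le> real (L 1) * G" using G by simp
  have "0 \<le> mean_hitting_time K L \<nu> x \<and> mean_hitting_time K L \<nu> x \<le> 2 * real (L 1) * G"
  proof (cases x)
    case Center
    then show ?thesis using c0 c1 LG by simp
  next
    case (Branch k l)
    have kl: "1 \<le> k" "k \<le> K" "1 \<le> l" "l \<le> L k" using x Branch by auto
    show ?thesis
    proof (cases "k = 1")
      case True
      have "(\<Sum>j=1..L 1. ?i 1 j) \<le> (\<Sum>j=1..l. ?i 1 j)"
      proof -
        have "(\<Sum>j=1..L 1. ?i 1 j) = (\<Sum>j=1..l. ?i 1 j) + (\<Sum>j=Suc l..L 1. ?i 1 j)"
          using kl True by (subst sum.union_disjoint[symmetric]) (auto intro!: sum.cong)
        moreover have "(\<Sum>j=Suc l..L 1. ?i 1 j) \<le> 0" using one by (intro sum_nonpos) auto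
        ultimately show ?thesis by simp
      qed
      moreover have "(\<Sum>j=1..l. ?i 1 j) \<le> 0" using one kl True by (intro sum_nonpos) auto
      ultimately show ?thesis using Branch True c0 c1 LG by (simp add: center_hitting_time_def)
    next
      case False
      have i: "0 \<le> ?i k j" "?i k j \<le> G" if "j \<in> {1..l}" for j
        using hitting_increment_bounds(2)[of k j] that kl False by (auto simp: G_def)
      have "(\<Sum>j=1..l. ?i k j) \<le> (\<Sum>j=1..l. G)" using i by (intro sum_mono) auto
      also have "\<dots> \<le> real (L 1) * G"
        using kl L_mono[of 1 k] G by (simp add: mult_right_mono)
      finally have "(\<Sum>j=1..l. ?i k j) \<le> real (L 1) * G" .
      moreover have "0 \<le> (\<Sum>j=1..l. ?i k j)" using i by (intro sum_nonneg) auto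
      ultimately show ?thesis using Branch c0 c1 by simp
    qed
  qed
  then show "0 \<le> mean_hitting_time K L \<nu> x" "mean_hitting_time K L \<nu> x \<le> 2 * real (L 1) * G" by auto
qed

section \<open>The two time scales\<close>

text \<open>All mean hitting times of the tip of branch 1 are at most of order \<open>\<nu> ^ (L 2 - 1)\<close>, and the stationary
  mass of the tip is bounded below, so the minorizing constant does not depend on \<open>\<nu>\<close>.\<close>
lemma star_minorization:
  assumes p: "transition_function (star_space K L) p"
    "has_transition_rates (star_space K L) (star_rate L \<nu>) p"
    and x: "x \<in> star_space K L"
  shows "(1 / (1 + real K * 2 ^ L 1))\<^sup>2 / 2
    \<le> p (4 * real (L 1) * (real K + 1) * 2 ^ L 1 * \<nu> ^ (L 2 - 1)) x (Branch 1 (L 1))"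
proof -
  interpret reversible_semigroup "star_space K L" "star_rate L \<nu>" p "star_pi K L \<nu>"
    using nu p by (intro star_reversible_semigroup) auto
  let ?H = "2 * real (L 1) * ((real K + 1) * 2 ^ L 1 * \<nu> ^ (L 2 - 1))"
  have "(1 / (1 + real K * 2 ^ L 1))\<^sup>2 / 2 \<le> (star_pi K L \<nu> (Branch 1 (L 1)))\<^sup>2 / 2"
    by (intro divide_right_mono power_mono star_pi_target_ge) simp_all
  also have "\<dots> \<le> p (2 * ?H) x (Branch 1 (L 1))"
  proof (rule minorization[of _ _ "mean_hitting_time K L \<nu>"])
    show "Branch 1 (L 1) \<in> star_space K L" using K L_pos[of 1] by simp
    show "0 < ?H" using K L_pos[of 1] nu by (auto intro!: mult_pos_pos)
  qed (use mean_hitting_time_bounds mean_hitting_time_generator x in \<open>auto simp: gen_def\<close>)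
  also have "2 * ?H = 4 * real (L 1) * (real K + 1) * 2 ^ L 1 * \<nu> ^ (L 2 - 1)" by simp
  finally show ?thesis .
qed

text \<open>The only exit from a branch is from its first level at rate 1, so the bottleneck ratio is that of
  the weights of level 1 and of the tip.\<close>
lemma branch_stay_prob:
  assumes p: "transition_function (star_space K L) p"
    "has_transition_rates (star_space K L) (star_rate L \<nu>) p"
    and t: "t \<ge> 0" and k: "1 \<le> k" "k \<le> K"
  shows "1 - t * (real (L k) / \<nu> ^ (L k - 1)) \<le> (\<Sum>y\<in>Branch k ` {1..L k}. p t (Branch k (L k)) y)"
proof -
  interpret reversible_semigroup "star_space K L" "star_rate L \<nu>" p "star_pi K L \<nu>"
    using nu p by (intro star_reversible_semigroup) auto
  let ?B = "Branch k ` {1..L k}" and ?S = "star_space K L" and ?\<pi> = "star_pi K L \<nu>"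
  have "(\<Sum>y\<in>?B. \<Sum>z\<in>?S - ?B. ?\<pi> y * star_rate L \<nu> y z) =
      (\<Sum>y\<in>?B. if y = Branch k 1 then ?\<pi> (Branch k 1) else 0)"
  proof (rule sum.cong[OF refl])
    fix y assume y: "y \<in> ?B"
    have "(\<Sum>z\<in>?S - ?B. ?\<pi> y * star_rate L \<nu> y z) = (\<Sum>z\<in>{Center}. ?\<pi> y * star_rate L \<nu> y z)"
    proof (intro sum.mono_neutral_right ballI)
      fix z assume z: "z \<in> ?S - ?B - {Center}"
      then obtain k' l' where "z = Branch k' l'" by (cases z) auto
      moreover from this have "k' \<noteq> k" using z by (auto simp: image_iff)
      ultimately show "?\<pi> y * star_rate L \<nu> y z = 0" using y by auto
    qed (auto simp: finite_star_space)
    also have "\<dots> = (if y = Branch k 1 then ?\<pi> (Branch k 1) else 0)"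
      using y by (auto split: if_splits)
    finally show "(\<Sum>z\<in>?S - ?B. ?\<pi> y * star_rate L \<nu> y z) =
        (if y = Branch k 1 then ?\<pi> (Branch k 1) else 0)" .
  qed
  also have "\<dots> = ?\<pi> (Branch k 1)" using L_pos[OF k] by (simp add: image_iff)
  finally have flow: "(\<Sum>y\<in>?B. \<Sum>z\<in>?S - ?B. ?\<pi> y * star_rate L \<nu> y z) = ?\<pi> (Branch k 1)" .
  obtain m where m: "L k = Suc m" using L_pos[OF k] by (cases "L k") auto
  have "(\<Sum>y\<in>?B. \<Sum>z\<in>?S - ?B. ?\<pi> y * star_rate L \<nu> y z) / ?\<pi> (Branch k (L k)) =
      real (L k) * \<nu> / \<nu> ^ L k"
    unfolding flow star_pi_eq using star_total_ge_1[of \<nu> K L] nu by (simp add: star_weight_def)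
  also have "\<dots> = real (L k) / \<nu> ^ (L k - 1)"
    using nu by (simp add: m)
  finally have ratio: "(\<Sum>y\<in>?B. \<Sum>z\<in>?S - ?B. ?\<pi> y * star_rate L \<nu> y z) / ?\<pi> (Branch k (L k)) =
      real (L k) / \<nu> ^ (L k - 1)"
    .
  have "1 - t * ((\<Sum>y\<in>?B. \<Sum>z\<in>?S - ?B. ?\<pi> y * star_rate L \<nu> y z) / ?\<pi> (Branch k (L k)))
      \<le> (\<Sum>y\<in>?B. p t (Branch k (L k)) y)"
    using L_pos[OF k] k t by (intro stay_prob_ge) auto
  then show ?thesis unfolding ratio .
qed

text \<open>All branches of maximal size have the same weight, whence the threshold for \<open>\<epsilon>\<close> in case of a tie.\<close>
lemma second_branch_mass_tie:
  assumes "L 1 = L 2"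
  shows "star_tail L \<nu> 2 1 / star_total K L \<nu> \<le> 1 / real (card {k\<in>{1..K}. L k = L 1})"
proof -
  let ?J = "{k\<in>{1..K}. L k = L 1}"
  have "1 \<in> ?J" using K by simp
  then have c: "0 < card ?J" by (subst card_gt_0_iff) auto
  have "real (card ?J) * star_tail L \<nu> 2 1 = (\<Sum>k\<in>?J. star_tail L \<nu> k 1)"
  proof -
    have "(\<Sum>k\<in>?J. star_tail L \<nu> k 1) = (\<Sum>k\<in>?J. star_tail L \<nu> 2 1)"
      using assms unfolding star_tail_1_eq by (intro sum.cong) auto
    then show ?thesis by simp
  qed
  also have "\<dots> \<le> (\<Sum>k=1..K. star_tail L \<nu> k 1)"
    using nu by (intro sum_mono2) (auto intro!: star_tail_nonneg)
  also have "\<dots> \<le> star_total K L \<nu>" by (simp add: star_total_def)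
  finally show ?thesis
    using c star_total_ge_1[of \<nu> K L] nu by (simp add: divide_simps mult.commute)
qed

lemma second_branch_mass_strict:
  assumes "L 1 \<noteq> L 2"
  shows "star_tail L \<nu> 2 1 / star_total K L \<nu> \<le> 1 / \<nu>"
proof -
  have less: "Suc (L 2) \<le> L 1" using assms L_mono[of 1 2] K by simp
  have pos: "0 \<le> (1 + \<nu>) ^ L 2" using nu by simp
  have "\<nu> * star_tail L \<nu> 2 1 \<le> (1 + \<nu>) ^ Suc (L 2) - 1"
  proof -
    have "\<nu> * star_tail L \<nu> 2 1 = ((1 + \<nu>) ^ Suc (L 2) - 1) - ((1 + \<nu>) ^ L 2 + \<nu> - 1)"
      unfolding star_tail_1_eq by (simp add: algebra_simps)
    then show ?thesis using pos nu by linarith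
  qed
  also have "\<dots> \<le> star_tail L \<nu> 1 1"
    unfolding star_tail_1_eq using less nu by (simp add: power_increasing del: power_Suc)
  also have "\<dots> \<le> (\<Sum>k=1..K. star_tail L \<nu> k 1)"
    using K nu by (intro member_le_sum) (auto intro!: star_tail_nonneg)
  also have "\<dots> \<le> star_total K L \<nu>" by (simp add: star_total_def)
  finally show ?thesis
    using star_total_ge_1[of \<nu> K L] nu by (simp add: divide_simps mult.commute)
qed

end

lemma measure_star_stationary:
  assumes "\<nu> > 0" "A \<subseteq> star_space K L"
  shows "measure (star_stationary K L \<nu>) A = (\<Sum>x\<in>A. star_pi K L \<nu> x)"
  unfolding star_stationary_def
proof (rule measure_point_measure[OF finite_star_space assms(2)])
  show "0 \<le> star_pi K L \<nu> x" if "x \<in> star_space K L" for x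
    using that assms(1) star_total_ge_1[OF assms(1), of K L] star_weight_pos[OF assms(1)]
    by (cases x) (auto simp: star_pi_eq less_imp_le simp del: star_pi.simps)
qed

lemma le_max_tv_dist:
  assumes "finite S" "x \<in> S" "A \<subseteq> S"
  shows "\<bar>measure (distr (M x) (count_space S) (X x t)) A - measure \<mu> A\<bar> \<le> max_tv_dist S M X \<mu> t"
  using assms max_tv_dist_le_iff[of S M X \<mu> t "max_tv_dist S M X \<mu> t"] by auto

lemma mixing_time_le:
  assumes "0 \<le> t" "max_tv_dist S M X \<mu> t \<le> \<epsilon>"
  shows "mixing_time S M X \<mu> \<epsilon> \<le> ereal t"
  unfolding mixing_time_def using assms by (intro INF_lower) auto

lemma mixing_time_ge:
  assumes "\<And>t. 0 \<le> t \<Longrightarrow> t < T \<Longrightarrow> \<epsilon> < max_tv_dist S M X \<mu> t"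
  shows "ereal T \<le> mixing_time S M X \<mu> \<epsilon>"
  unfolding mixing_time_def using assms by (intro INF_greatest) (force simp: not_le[symmetric])

context fast_star
begin

lemma mixing_time_upper:
  assumes mp: "\<And>x. x \<in> star_space K L \<Longrightarrow>
      markov_process (M x) (star_space K L) (star_rate L \<nu>) x (X x)"
    and n: "(1 - (1 / (1 + real K * 2 ^ L 1))\<^sup>2 / 2) ^ n \<le> \<epsilon>"
  shows "mixing_time (star_space K L) M X (star_stationary K L \<nu>) \<epsilon>
    \<le> ereal (real n * (4 * real (L 1) * (real K + 1) * 2 ^ L 1 * \<nu> ^ (L 2 - 1)))"
proof (rule mixing_time_le)
  let ?S = "star_space K L" and ?T = "4 * real (L 1) * (real K + 1) * 2 ^ L 1 * \<nu> ^ (L 2 - 1)"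
  have ne: "?S \<noteq> {}" using Center_in_star_space by blast
  show T: "0 \<le> real n * ?T" using nu by simp
  have "\<bar>measure (distr (M x) (count_space ?S) (X x (real n * ?T))) A - measure (star_stationary K L \<nu>) A\<bar> \<le> \<epsilon>"
    if x: "x \<in> ?S" and A: "A \<subseteq> ?S" for x A
  proof -
    obtain p where p: "transition_function ?S p" "has_transition_rates ?S (star_rate L \<nu>) p"
      and law: "\<And>t A. t \<ge> 0 \<Longrightarrow> A \<subseteq> ?S \<Longrightarrow>
        measure (distr (M x) (count_space ?S) (X x t)) A = (\<Sum>y\<in>A. p t x y)"
      using markov_process_law[OF mp[OF x] finite_star_space x] by metis
    interpret reversible_semigroup ?S "star_rate L \<nu>" p "star_pi K L \<nu>"
      using nu p by (intro star_reversible_semigroup) auto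
    have "\<bar>(\<Sum>y\<in>A. p (real n * ?T) x y) - (\<Sum>y\<in>A. star_pi K L \<nu> y)\<bar>
        \<le> (1 - (1 / (1 + real K * 2 ^ L 1))\<^sup>2 / 2) ^ n"
    proof (rule geometric_convergence[where a = "Branch 1 (L 1)"])
      show "Branch 1 (L 1) \<in> ?S" using K L_pos[of 1] by simp
      show "(1 / (1 + real K * 2 ^ L 1))\<^sup>2 / 2 \<le> p ?T y (Branch 1 (L 1))" if "y \<in> ?S" for y
        using star_minorization[OF p that] by simp
    qed (use nu x A in auto)
    then show ?thesis
      using n law[OF T A] measure_star_stationary[of \<nu> A K L] A nu by simp
  qed
  then show "max_tv_dist ?S M X (star_stationary K L \<nu>) (real n * ?T) \<le> \<epsilon>"
    using finite_star_space ne by (subst max_tv_dist_le_iff) auto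
qed

lemma mixing_time_lower:
  assumes mp: "\<And>x. x \<in> star_space K L \<Longrightarrow>
      markov_process (M x) (star_space K L) (star_rate L \<nu>) x (X x)"
    and C: "C * real (L 2) \<le> 1 - \<epsilon> - star_tail L \<nu> 2 1 / star_total K L \<nu>"
  shows "ereal (C * \<nu> ^ (L 2 - 1))
    \<le> mixing_time (star_space K L) M X (star_stationary K L \<nu>) \<epsilon>"
proof (rule mixing_time_ge)
  let ?S = "star_space K L" and ?x = "Branch 2 (L 2)" and ?B = "Branch 2 ` {1..L 2}"
  fix t assume t: "0 \<le> t" "t < C * \<nu> ^ (L 2 - 1)"
  have x: "?x \<in> ?S" and B: "?B \<subseteq> ?S" using K L_pos[of 2] by auto
  obtain p where p: "transition_function ?S p" "has_transition_rates ?S (star_rate L \<nu>) p"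
    and law: "\<And>t A. t \<ge> 0 \<Longrightarrow> A \<subseteq> ?S \<Longrightarrow>
      measure (distr (M ?x) (count_space ?S) (X ?x t)) A = (\<Sum>y\<in>A. p t ?x y)"
    using markov_process_law[OF mp[OF x] finite_star_space x] by metis
  have "t * (real (L 2) / \<nu> ^ (L 2 - 1)) < C * \<nu> ^ (L 2 - 1) * (real (L 2) / \<nu> ^ (L 2 - 1))"
    using t nu L_pos[of 2] K by (intro mult_strict_right_mono) auto
  also have "\<dots> = C * real (L 2)" using nu by simp
  finally have "t * (real (L 2) / \<nu> ^ (L 2 - 1)) < C * real (L 2)" .
  moreover have "1 - t * (real (L 2) / \<nu> ^ (L 2 - 1)) \<le> (\<Sum>y\<in>?B. p t ?x y)"
    using branch_stay_prob[OF p t(1), of 2] K by simp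
  ultimately have "\<epsilon> < (\<Sum>y\<in>?B. p t ?x y) - (\<Sum>y\<in>?B. star_pi K L \<nu> y)"
    unfolding star_pi_branch using C by linarith
  also have "\<dots> \<le> \<bar>measure (distr (M ?x) (count_space ?S) (X ?x t)) ?B - measure (star_stationary K L \<nu>) ?B\<bar>"
    using law[OF t(1) B] measure_star_stationary[OF _ B, of \<nu>] nu by simp
  also have "\<dots> \<le> max_tv_dist ?S M X (star_stationary K L \<nu>) t"
    by (rule le_max_tv_dist[OF finite_star_space x B])
  finally show "\<epsilon> < max_tv_dist ?S M X (star_stationary K L \<nu>) t" .
qed

end

section \<open>Order of the mixing time\<close>

theorem theoremV1:
  fixes K :: nat and L :: "nat \<Rightarrow> nat" and \<epsilon> :: real
    and M :: "real \<Rightarrow> star_state \<Rightarrow> 'w measure"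
    and X :: "real \<Rightarrow> star_state \<Rightarrow> real \<Rightarrow> 'w \<Rightarrow> star_state"
  assumes "K \<ge> 2"
    and "\<And>k. 1 \<le> k \<Longrightarrow> k \<le> K \<Longrightarrow> L k \<ge> 1"
    and "\<And>j k. 1 \<le> j \<Longrightarrow> j \<le> k \<Longrightarrow> k \<le> K \<Longrightarrow> L k \<le> L j"
    and "\<And>\<nu> x. \<nu> > 0 \<Longrightarrow> x \<in> star_space K L \<Longrightarrow>
           markov_process (M \<nu> x) (star_space K L) (star_rate L \<nu>) x (X \<nu> x)"
    and "0 < \<epsilon>" and "\<epsilon> < 1"
    and "L 1 = L 2 \<Longrightarrow> \<epsilon> < 1 - 1 / real (card {k\<in>{1..K}. L k = L 1})"
  shows "\<exists>C1>0. \<exists>C2>0. \<exists>\<nu>0>0. \<forall>\<nu>>\<nu>0.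
    ereal (C1 * \<nu> ^ (L 2 - 1))
      \<le> mixing_time (star_space K L) (M \<nu>) (X \<nu>) (star_stationary K L \<nu>) \<epsilon> \<and>
    mixing_time (star_space K L) (M \<nu>) (X \<nu>) (star_stationary K L \<nu>) \<epsilon>
      \<le> ereal (C2 * \<nu> ^ (L 2 - 1))"
proof -
  define c where "c = (1 / (1 + real K * 2 ^ L 1))\<^sup>2 / 2"
  have "0 < 1 / (1 + real K * 2 ^ L 1)" "1 / (1 + real K * 2 ^ L 1) \<le> 1"
    by (simp_all add: add_pos_nonneg)
  then have "0 < c" "c < 1"
    using power_le_one[of "1 / (1 + real K * 2 ^ L 1)" 2] unfolding c_def by (simp, linarith)
  then obtain n where n: "(1 - c) ^ n < \<epsilon>"
    using real_arch_pow_inv[of \<epsilon> "1 - c"] assms(5) by auto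
  have n0: "0 < n" using n assms(6) by (cases n) auto
  \<comment> \<open>an upper bound below \<open>1 - \<epsilon>\<close> for the stationary mass of branch 2; without a tie that mass
    is at most \<open>1 / \<nu>\<close>, so any positive bound is eventually valid\<close>
  define b where "b = (if L 1 = L 2 then 1 / real (card {k\<in>{1..K}. L k = L 1}) else (1 - \<epsilon>) / 2)"
  have b: "b < 1 - \<epsilon>"
  proof (cases "L 1 = L 2")
    case True
    then show ?thesis using assms(7)[OF True] unfolding b_def if_P[OF True] by linarith
  qed (use assms(6) in \<open>simp add: b_def\<close>)
  define C1 where "C1 = (1 - \<epsilon> - b) / real (L 2)"
  define C2 where "C2 = real n * (4 * real (L 1) * (real K + 1) * 2 ^ L 1)"
  define \<nu>0 where "\<nu>0 = 1 + 2 / (1 - \<epsilon>)"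
  have L: "0 < L 1" "0 < L 2" using assms(1) assms(2)[of 1] assms(2)[of 2] by auto
  have "0 < C1" using b L by (simp add: C1_def)
  moreover have "0 < C2" using n0 L by (simp add: C2_def add_pos_nonneg)
  moreover have "0 < \<nu>0" using assms(6) by (simp add: \<nu>0_def add_pos_pos)
  moreover have "ereal (C1 * \<nu> ^ (L 2 - 1))
      \<le> mixing_time (star_space K L) (M \<nu>) (X \<nu>) (star_stationary K L \<nu>) \<epsilon>"
    (is ?lower)
    and "mixing_time (star_space K L) (M \<nu>) (X \<nu>) (star_stationary K L \<nu>) \<epsilon>
      \<le> ereal (C2 * \<nu> ^ (L 2 - 1))" (is ?upper) if "\<nu> > \<nu>0" for \<nu>
  proof -
    have e: "0 < 2 / (1 - \<epsilon>)" using assms(6) by simp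
    then have large: "1 \<le> \<nu>" "2 / (1 - \<epsilon>) \<le> \<nu>" using that unfolding \<nu>0_def by linarith+
    interpret fast_star K L \<nu> using assms(1-3) large(1) by unfold_locales
    have mp: "markov_process (M \<nu> x) (star_space K L) (star_rate L \<nu>) x (X \<nu> x)"
      if "x \<in> star_space K L" for x
      using assms(4) large that by simp
    have "2 \<le> \<nu> * (1 - \<epsilon>)" using large(2) assms(6) by (simp only: pos_divide_le_eq diff_gt_0_iff_gt)
    then have inv: "1 / \<nu> \<le> (1 - \<epsilon>) / 2" using large(1) by (simp add: pos_divide_le_eq mult.commute)
    have "star_tail L \<nu> 2 1 / star_total K L \<nu> \<le> b"
    proof (cases "L 1 = L 2")
      case True
      then show ?thesis unfolding b_def if_P[OF True] by (rule second_branch_mass_tie)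
    next
      case False
      then show ?thesis
        unfolding b_def if_not_P[OF False] using second_branch_mass_strict inv by linarith
    qed
    then show ?lower
      using L by (intro mixing_time_lower[OF mp]) (auto simp: C1_def)
    show ?upper
      using mixing_time_upper[OF mp, of n \<epsilon>] n
      by (simp add: c_def C2_def mult.assoc)
  qed
  ultimately show ?thesis by blast
qed

end
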